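(* Let $d\ge2$ and let $X_t^{(i,\rho)}=Y^{(i,\rho)}+W_t^{(i,\rho)}$, $t\ge0$, where $Y^{(i,\rho)}$ are the points of a homogeneous Poisson process on $\mathbb{R}^{d-1}$ of intensity $\rho$ and $W^{(i,\rho)}$ are independent Brownian motions in $\mathbb{R}^{d-1}$. Then there exist constants $0<c_1\le c_2<\infty$ such that $$\mathbb{P}\left(c_1\le\frac{R_\rho(B'_{d-1}(o,1))}{(\log\rho/\rho)^{1/(d-1)}}\le c_2\right)\to 1\qquad\text{as }\rho\to\infty,$$ where $R_\rho$ is the coverage radius of the associated generalized cylinder model.
   Context: Notation: $B_{d-1}(o,r)$ is the closed Euclidean ball in $\mathbb{R}^{d-1}$ with centre the origin and radius $r$; $B'_{d-1}(o,r)=B_{d-1}(o,r)\times\{0\}\subset\mathbb{R}^d$; $\oplus$ is Minkowski sum; $rK=\{rx:x\in K\}$. Generalized cylinder model: for $\rho>0$ let $\eta_\rho=\{Y^{(1,\rho)},Y^{(2,\rho)},\dots\}$ be a homogeneous Poisson point process on $\mathbb{R}^{d-1}$ with intensity measure $\rho$ times Lebesgue measure. Let $\xi_\rho=\eta_\rho([0,1]^{d-1})$ and index the points so that $Y^{(1,\rho)},\dots,Y^{(\xi_\rho,\rho)}$ are those in $[0,1]^{d-1}$. Let $W^{(i,\rho)}$, $i\in\mathbb{N}$, be independent standard Brownian motions in $\mathbb{R}^{d-1}$ started at the origin, independent of $\eta_\rho$. The trajectory of the $i$-th point is $X^{(i,\rho)}=\{(X_t^{(i,\rho)},t):\ t\ge0\}\subset\mathbb{R}^d$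 with $X_t^{(i,\rho)}=Y^{(i,\rho)}+W_t^{(i,\rho)}$. For $K\subset\mathbb{R}^d$ put $\mathcal{X}_\rho(K)=\bigcup_{i=1}^{\xi_\rho}\big(X^{(i,\rho)}\oplus K\big)$, and define the coverage radius $R_\rho(K)=\inf\{r\ge0:\ \mathcal{X}_\rho(rK)\supset[0,1]^d\}$, with $\inf\emptyset=\infty$. *)

theory Defs
  imports "HOL-Probability.Probability" "HOL-Library.Set_Algebras"
begin

text \<open>
  Throughout, \<open>real ^ 'n\<close> is the space $R^{d-1}$, so that \<open>d = CARD('n) + 1\<close>, and
  \<open>(real ^ 'n) \<times> real\<close> is $R^d$, the last coordinate being time.
\<close>

section \<open>Homogeneous Poisson processes\<close>

text \<open>
  A point process is given by a random enumeration \<open>Y 0, Y 1, \<dots>\<close> of its points. Points are counted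
  by index, that is, with multiplicity.
\<close>

definition point_count :: "(nat \<Rightarrow> 'w \<Rightarrow> real ^ 'n) \<Rightarrow> (real ^ 'n) set \<Rightarrow> 'w \<Rightarrow> nat" where
  "point_count Y A \<omega> = card {i. Y i \<omega> \<in> A}"

text \<open>
  The mass function is written out because \<^const>\<open>poisson_pmf\<close> is meant for positive rates only,
  while null sets \<open>A\<close> give rate \<open>0\<close>.
\<close>

definition (in prob_space) poisson_process :: "real \<Rightarrow> (nat \<Rightarrow> 'a \<Rightarrow> real ^ 'n) \<Rightarrow> bool" where
  "poisson_process \<rho> Y \<longleftrightarrow>
     (\<forall>i. random_variable borel (Y i)) \<and>
     (\<forall>\<omega>\<in>space M. \<forall>A. bounded A \<longrightarrow> finite {i. Y i \<omega> \<in> A}) \<and>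
     (\<forall>A\<in>sets borel. bounded A \<longrightarrow>
        (\<forall>k. prob {\<omega>\<in>space M. point_count Y A \<omega> = k} =
           exp (- (\<rho> * measure lborel A)) * (\<rho> * measure lborel A) ^ k / fact k)) \<and>
     (\<forall>(A :: nat \<Rightarrow> (real ^ 'n) set) m.
        (\<forall>j<m. A j \<in> sets borel \<and> bounded (A j)) \<longrightarrow> disjoint_family_on A {..<m} \<longrightarrow>
        indep_vars (\<lambda>_. count_space UNIV) (\<lambda>j. point_count Y (A j)) {..<m})"

section \<open>Brownian motion\<close>

definition (in prob_space) standard_brownian_motion :: "(real \<Rightarrow> 'a \<Rightarrow> real ^ 'n) \<Rightarrow> bool" where
  "standard_brownian_motion W \<longleftrightarrow>
     (\<forall>t\<ge>0. random_variable borel (W t)) \<and>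
     (\<forall>\<omega>\<in>space M. W 0 \<omega> = 0) \<and>
     (\<forall>\<omega>\<in>space M. continuous_on {0..} (\<lambda>t. W t \<omega>)) \<and>
     (\<forall>s t. 0 \<le> s \<longrightarrow> s < t \<longrightarrow>
        distributed M lborel (\<lambda>\<omega>. W t \<omega> - W s \<omega>)
          (\<lambda>x. ennreal (\<Prod>i\<in>UNIV. normal_density 0 (sqrt (t - s)) (x $ i)))) \<and>
     (\<forall>(t :: nat \<Rightarrow> real) m. 0 \<le> t 0 \<longrightarrow> mono_on {..m} t \<longrightarrow>
        indep_vars (\<lambda>_. borel) (\<lambda>k \<omega>. W (t (Suc k)) \<omega> - W (t k) \<omega>) {..<m})"

section \<open>The generalized cylinder model\<close>

text \<open>
  The point with index \<open>i\<close> is \<open>Y \<rho> i\<close>, and indices start at \<open>0\<close>, so the points in the unit cube are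
  those with index below the number \<open>\<xi>\<close> of points in the cube. No relation is required between the
  models for different values of \<open>\<rho>\<close>. Independence of the Brownian motions from the Poisson process
  means independence from its enumeration: the numbering of the points must not look at the motions.
\<close>

locale generalized_cylinder_model = prob_space M
  for M :: "'w measure"
    and Y :: "real \<Rightarrow> nat \<Rightarrow> 'w \<Rightarrow> real ^ 'n"
    and W :: "real \<Rightarrow> nat \<Rightarrow> real \<Rightarrow> 'w \<Rightarrow> real ^ 'n" +
  assumes poisson: "\<rho> > 0 \<Longrightarrow> poisson_process \<rho> (Y \<rho>)"
    and indexing: "\<rho> > 0 \<Longrightarrow> \<omega> \<in> space M \<Longrightarrow>
      Y \<rho> i \<omega> \<in> cbox 0 1 \<longleftrightarrow> i < point_count (Y \<rho>) (cbox 0 1) \<omega>"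
    and brownian: "\<rho> > 0 \<Longrightarrow> standard_brownian_motion (W \<rho> i)"
    and indep_brownian: "\<rho> > 0 \<Longrightarrow>
      indep_vars (\<lambda>_. \<Pi>\<^sub>M t\<in>{0..}. borel) (\<lambda>i \<omega>. \<lambda>t\<in>{0..}. W \<rho> i t \<omega>) UNIV"
    and indep_points_brownian: "\<rho> > 0 \<Longrightarrow>
      indep_set
        (sets (vimage_algebra (space M) (\<lambda>\<omega> i. Y \<rho> i \<omega>) (\<Pi>\<^sub>M i\<in>UNIV. borel)))
        (sets (vimage_algebra (space M) (\<lambda>\<omega>. \<lambda>(i, t)\<in>UNIV \<times> {0..}. W \<rho> i t \<omega>)
          (\<Pi>\<^sub>M p\<in>UNIV \<times> {0..}. borel)))"

definition trajectory :: "(real \<Rightarrow> real ^ 'n) \<Rightarrow> ((real ^ 'n) \<times> real) set" where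
  "trajectory x = {(x t, t) | t. 0 \<le> t}"

definition cylinder_union ::
  "(real \<Rightarrow> nat \<Rightarrow> 'w \<Rightarrow> real ^ 'n) \<Rightarrow> (real \<Rightarrow> nat \<Rightarrow> real \<Rightarrow> 'w \<Rightarrow> real ^ 'n) \<Rightarrow>
    real \<Rightarrow> ((real ^ 'n) \<times> real) set \<Rightarrow> 'w \<Rightarrow> ((real ^ 'n) \<times> real) set" where
  "cylinder_union Y W \<rho> K \<omega> =
     (\<Union>i<point_count (Y \<rho>) (cbox 0 1) \<omega>. trajectory (\<lambda>t. Y \<rho> i \<omega> + W \<rho> i t \<omega>) + K)"

text \<open>The infimum is taken in \<^typ>\<open>ereal\<close>, where \<open>Inf {} = \<infinity>\<close>.\<close>

definition coverage_radius ::
  "(real \<Rightarrow> nat \<Rightarrow> 'w \<Rightarrow> real ^ 'n) \<Rightarrow> (real \<Rightarrow> nat \<Rightarrow> real \<Rightarrow> 'w \<Rightarrow> real ^ 'n) \<Rightarrow>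
    real \<Rightarrow> ((real ^ 'n) \<times> real) set \<Rightarrow> 'w \<Rightarrow> ereal" where
  "coverage_radius Y W \<rho> K \<omega> =
     Inf {ereal r | r. 0 \<le> r \<and> cbox 0 1 \<times> {0..1} \<subseteq> cylinder_union Y W \<rho> ((*\<^sub>R) r ` K) \<omega>}"

end

theory Submission
  imports Defs "HOL-Real_Asymp.Real_Asymp"
begin

text \<open>
  Write \<open>n = d - 1\<close> for the dimension of space. Divide the unit cube into \<open>K ^ n\<close> cells of side
  \<open>1 / K\<close>. At any given time a given cell contains no point with probability roughly
  \<open>exp (- c * \<rho> / K ^ n)\<close>. If the volume of a cell is a small multiple of \<open>ln \<rho> / \<rho>\<close>, this is a small
  negative power of \<open>\<rho>\<close>, and among the almost \<open>\<rho>\<close> cells some are empty; if it is a large multiple, it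
  is a large negative power of \<open>\<rho>\<close>, and no cell is empty at any of polynomially many times. Hence the
  coverage radius is of the order of the side of a cell with volume \<open>ln \<rho> / \<rho>\<close>.

  The lower bound needs time \<open>0\<close> only, when the points form the Poisson process itself. The counts of
  the cells are independent, and the midpoint of an empty cell is at distance at least \<open>1 / (2 * K)\<close>
  from every point (\<open>prob_radius_small\<close>).

  For the upper bound (\<open>coverage_failure\<close>) there are two issues. The first is the density of the
  points at a time \<open>t > 0\<close>, since points leave the cube and none come in. The probability that no point
  starting in a set \<open>D j\<close> has its displacement in \<open>C j\<close>, for any \<open>j\<close>, is exactly
  \<open>exp (- \<rho> * (\<Sum>j. volume (D j) * P (W t \<in> C j)))\<close>, by Fubini and the generating function of Poisson
  counts (\<open>prob_no_transfer\<close>). To reach the target \<open>k\<close>, pair the starting cell \<open>j\<close> with the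
  displacement cell \<open>k - j\<close>. Over all \<open>j\<close> in the cube these displacement cells tile a box of side one
  with the origin inside or on its boundary, and such a box has Gaussian mass bounded below for all
  \<open>t \<le> 1\<close>: at least half of every side is on the same side of the origin (\<open>brownian_cells\<close>). So the density
  of the points is at least a constant times \<open>\<rho>\<close> everywhere in the cube (\<open>grid_point_hit\<close>).

  The second issue is the passage from grid times to all times. Increments over an interval of length
  \<open>h\<close> have Gaussian tails, so by dyadic chaining a motion oscillates by more than \<open>10 * a\<close> with
  probability at most of order \<open>h\<^sup>2 / a ^ 4\<close> (\<open>brownian_oscillation\<close>). With \<open>h\<close> a sufficiently large
  negative power of \<open>\<rho>\<close> this survives a union bound over all points and all intervals. It concerns every
  point, so that no joint law of position and oscillation is needed.
\<close>

section \<open>Gaussian estimates for Brownian motion\<close>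

lemma gauss_density:
  fixes x :: "real ^ 'n"
  assumes "0 < \<tau>"
  shows "(\<Prod>i\<in>UNIV. normal_density 0 (sqrt \<tau>) (x $ i)) =
    (1 / sqrt (2 * pi * \<tau>)) ^ CARD('n) * exp (- (norm x)\<^sup>2 / (2 * \<tau>))"
proof -
  have "(\<Prod>i\<in>UNIV. normal_density 0 (sqrt \<tau>) (x $ i)) =
      (\<Prod>i\<in>(UNIV::'n set). 1 / sqrt (2 * pi * \<tau>)) * (\<Prod>i\<in>UNIV. exp (- (x $ i)\<^sup>2 / (2 * \<tau>)))"
    using assms unfolding prod.distrib[symmetric] by (simp add: normal_density_def)
  also have "(\<Prod>i\<in>UNIV. exp (- (x $ i)\<^sup>2 / (2 * \<tau>))) = exp (\<Sum>i\<in>UNIV. - (x $ i)\<^sup>2 / (2 * \<tau>))"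
    by (simp add: exp_sum)
  also have "(\<Sum>i\<in>UNIV. - (x $ i)\<^sup>2 / (2 * \<tau>)) = - (norm x)\<^sup>2 / (2 * \<tau>)"
    by (simp add: power2_norm_eq_inner inner_vec_def power2_eq_square[of "x $ _"] sum_divide_distrib sum_negf)
  finally show ?thesis by simp
qed

context prob_space
begin

lemma brownian_measurable:
  "standard_brownian_motion W \<Longrightarrow> 0 \<le> t \<Longrightarrow> random_variable borel (W t)"
  unfolding standard_brownian_motion_def by blast

lemma brownian_continuous:
  "standard_brownian_motion W \<Longrightarrow> \<omega> \<in> space M \<Longrightarrow> continuous_on {0..} (\<lambda>t. W t \<omega>)"
  unfolding standard_brownian_motion_def by blast

lemma brownian_start:
  "standard_brownian_motion W \<Longrightarrow> \<omega> \<in> space M \<Longrightarrow> W 0 \<omega> = 0"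
  unfolding standard_brownian_motion_def by blast

lemma brownian_increment:
  fixes W :: "real \<Rightarrow> 'a \<Rightarrow> real ^ 'n"
  assumes "standard_brownian_motion W" "0 \<le> s" "s < t"
  shows "distributed M lborel (\<lambda>\<omega>. W t \<omega> - W s \<omega>)
    (\<lambda>x. ennreal (\<Prod>i\<in>UNIV. normal_density 0 (sqrt (t - s)) (x $ i)))"
  using assms unfolding standard_brownian_motion_def by blast

lemma brownian_law:
  fixes W W' :: "real \<Rightarrow> 'a \<Rightarrow> real ^ 'n"
  assumes W: "standard_brownian_motion W" and W': "standard_brownian_motion W'"
    and t: "0 < t" and A: "A \<in> sets borel"
  shows "prob {\<omega> \<in> space M. W t \<omega> \<in> A} = prob {\<omega> \<in> space M. W' t \<omega> \<in> A}"
proof -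
  have eq: "{\<omega> \<in> space M. V t \<omega> \<in> A} = (\<lambda>\<omega>. V t \<omega> - V 0 \<omega>) -` A \<inter> space M"
    if "standard_brownian_motion V" for V :: "real \<Rightarrow> 'a \<Rightarrow> real ^ 'n"
    using brownian_start[OF that] by auto
  have "emeasure M {\<omega> \<in> space M. W t \<omega> \<in> A} = emeasure M {\<omega> \<in> space M. W' t \<omega> \<in> A}"
    unfolding eq[OF W] eq[OF W'] using A t
      distributed_emeasure[OF brownian_increment[OF W order_refl t], of A]
      distributed_emeasure[OF brownian_increment[OF W' order_refl t], of A] by simp
  then show ?thesis by (simp add: measure_def)
qed

text \<open>
  The product structure of the density is not integrated out: the tail is compared pointwise with the
  density of variance \<open>2 * (t - s)\<close>, which is that of another increment and so has mass one. The
  comparison costs the factor \<open>sqrt 2\<close> per dimension.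
\<close>

lemma brownian_tail:
  fixes W :: "real \<Rightarrow> 'a \<Rightarrow> real ^ 'n"
  assumes W: "standard_brownian_motion W" and st: "0 \<le> s" "s < t" and a: "0 \<le> a"
  shows "prob {\<omega> \<in> space M. a < norm (W t \<omega> - W s \<omega>)} \<le> sqrt 2 ^ CARD('n) * exp (- a\<^sup>2 / (4 * (t - s)))"
proof -
  define \<tau> where "\<tau> = t - s"
  have \<tau>: "\<tau> > 0" using st by (simp add: \<tau>_def)
  define g where "g \<tau> x = (\<Prod>i\<in>UNIV. normal_density 0 (sqrt \<tau>) (x $ i))" for \<tau> and x :: "real ^ 'n"
  have D1: "distributed M lborel (\<lambda>\<omega>. W t \<omega> - W s \<omega>) (\<lambda>x. ennreal (g \<tau> x))"
    using brownian_increment[OF W st] by (simp add: g_def \<tau>_def)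
  have D2: "distributed M lborel (\<lambda>\<omega>. W (2 * \<tau>) \<omega> - W 0 \<omega>) (\<lambda>x. ennreal (g (2 * \<tau>) x))"
    using brownian_increment[OF W, of 0 "2 * \<tau>"] \<tau> by (simp add: g_def)
  define c where "c = sqrt 2 ^ CARD('n) * exp (- a\<^sup>2 / (4 * \<tau>))"
  have c: "c \<ge> 0" by (simp add: c_def)
  have [measurable]: "g \<tau> \<in> borel_measurable borel" for \<tau> unfolding g_def by measurable
  \<comment> \<open>Outside the ball of radius \<open>a\<close>, half of the exponent is bounded by its value on the sphere, and the
    other half is the exponent of the density with variance \<open>2 * \<tau>\<close>, whose total mass is one.\<close>
  have le: "g \<tau> x \<le> c * g (2 * \<tau>) x" if "a < norm x" for x
  proof -
    have "a\<^sup>2 \<le> (norm x)\<^sup>2"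
      using a that by (intro power_mono) auto
    then have "exp (- (norm x)\<^sup>2 / (2 * \<tau>)) \<le> exp (- a\<^sup>2 / (4 * \<tau>)) * exp (- (norm x)\<^sup>2 / (2 * (2 * \<tau>)))"
      using \<tau> by (simp add: exp_add[symmetric] field_simps)
    moreover have "(1 / sqrt (2 * pi * \<tau>)) ^ CARD('n) = sqrt 2 ^ CARD('n) * (1 / sqrt (2 * pi * (2 * \<tau>))) ^ CARD('n)"
    proof -
      have "1 / sqrt (2 * pi * \<tau>) = sqrt 2 * (1 / sqrt (2 * pi * (2 * \<tau>)))"
        by (simp add: real_sqrt_mult divide_simps)
      then show ?thesis by (simp only: power_mult_distrib)
    qed
    ultimately have "(1 / sqrt (2 * pi * \<tau>)) ^ CARD('n) * exp (- (norm x)\<^sup>2 / (2 * \<tau>)) \<le>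
        (sqrt 2 ^ CARD('n) * (1 / sqrt (2 * pi * (2 * \<tau>))) ^ CARD('n)) *
        (exp (- a\<^sup>2 / (4 * \<tau>)) * exp (- (norm x)\<^sup>2 / (2 * (2 * \<tau>))))"
      using \<tau> by (simp add: mult_left_mono)
    then show ?thesis
      using \<tau> unfolding g_def c_def gauss_density[OF \<tau>] gauss_density[of "2 * \<tau>", OF mult_pos_pos[OF zero_less_numeral \<tau>]]
      by (simp only: mult_ac)
  qed
  have "emeasure M {\<omega> \<in> space M. a < norm (W t \<omega> - W s \<omega>)} =
     (\<integral>\<^sup>+x. ennreal (g \<tau> x) * indicator {x. a < norm x} x \<partial>lborel)"
    using distributed_emeasure[OF D1, of "{x. a < norm x}"]
    by (simp add: vimage_def Int_def conj_commute)
  also have "\<dots> \<le> (\<integral>\<^sup>+x. ennreal c * ennreal (g (2 * \<tau>) x) \<partial>lborel)"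
    using le c by (intro nn_integral_mono) (auto simp: indicator_def ennreal_mult'[symmetric] intro!: ennreal_leI)
  also have "\<dots> = ennreal c * (\<integral>\<^sup>+x. ennreal (g (2 * \<tau>) x) * indicator UNIV x \<partial>lborel)"
    by (simp add: nn_integral_cmult)
  also have "(\<integral>\<^sup>+x. ennreal (g (2 * \<tau>) x) * indicator UNIV x \<partial>lborel) = emeasure M (space M)"
    using distributed_emeasure[OF D2, of UNIV] by simp
  finally show ?thesis
    using c by (simp add: emeasure_eq_measure prob_space c_def \<tau>_def)
qed

text \<open>
  A power of the interval length that exceeds one is what the chaining needs, because it must pay for
  the number of dyadic intervals.
\<close>

lemma brownian_tail_power:
  fixes W :: "real \<Rightarrow> 'a \<Rightarrow> real ^ 'n"
  assumes W: "standard_brownian_motion W" and st: "0 \<le> s" "s < t" and a: "0 < a"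
  shows "prob {\<omega> \<in> space M. a < norm (W t \<omega> - W s \<omega>)} \<le> 32 * sqrt 2 ^ CARD('n) * ((t - s)\<^sup>2 / a ^ 4)"
proof -
  define \<tau> where "\<tau> = t - s"
  have \<tau>: "0 < \<tau>" using st(2) unfolding \<tau>_def by (rule diff_gt_0_iff_gt[THEN iffD2])
  have "exp (- (a\<^sup>2 / (4 * \<tau>))) \<le> 32 * (\<tau>\<^sup>2 / a ^ 4)"
  proof -
    define x where "x = a\<^sup>2 / (4 * \<tau>)"
    have x: "0 < x" unfolding x_def by (intro divide_pos_pos zero_less_power a mult_pos_pos \<tau>) simp
    have "x\<^sup>2 / 2 \<le> exp x"
      using exp_lower_Taylor_quadratic[OF less_imp_le[OF x]] x by linarith
    then have "inverse (exp x) \<le> inverse (x\<^sup>2 / 2)"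
      using x by (intro le_imp_inverse_le) auto
    also have "inverse (x\<^sup>2 / 2) = 32 * (\<tau>\<^sup>2 / a ^ 4)"
      by (simp add: x_def power_divide power_mult_distrib flip: power_mult)
    finally show ?thesis by (simp add: exp_minus x_def)
  qed
  then have "sqrt 2 ^ CARD('n) * exp (- a\<^sup>2 / (4 * \<tau>)) \<le> sqrt 2 ^ CARD('n) * (32 * (\<tau>\<^sup>2 / a ^ 4))"
    by (intro mult_left_mono) simp_all
  also have "\<dots> = 32 * sqrt 2 ^ CARD('n) * (\<tau>\<^sup>2 / a ^ 4)"
    by (simp only: mult_ac)
  finally show ?thesis
    using brownian_tail[OF W st less_imp_le[OF a]] unfolding \<tau>_def by (rule order_trans[rotated])
qed

end

text \<open>
  The deterministic half of the Kolmogorov continuity argument.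
\<close>

lemma dyadic_chain:
  fixes w :: "real \<Rightarrow> 'b::real_normed_vector"
  assumes incr: "\<And>j k. k < 2 ^ j \<Longrightarrow> norm (w (real (Suc k) / 2 ^ j) - w (real k / 2 ^ j)) \<le> a * q ^ j"
    and q: "0 \<le> q" "q < 1" and "0 \<le> a" and cont: "continuous_on {0..1} w" and s: "s \<in> {0..1}"
  shows "norm (w s - w 0) \<le> a / (1 - q)"
proof -
  have dyadic: "norm (w (real k / 2 ^ j) - w 0) \<le> a * (\<Sum>i\<le>j. q ^ i)" if "k \<le> 2 ^ j" for j k
    using that
  proof (induction j arbitrary: k)
    case 0
    then consider "k = 0" | "k = 1" by fastforce
    then show ?case using \<open>0 \<le> a\<close> incr[of 0 0] by cases auto
  next
    case (Suc j)
    \<comment> \<open>Move from \<open>k / 2 ^ Suc j\<close> to the neighbour \<open>m / 2 ^ j\<close> on the coarser grid, by one step or none.\<close>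
    define m where "m = k div 2"
    have "m \<le> 2 ^ j" using Suc.prems by (simp add: m_def)
    note IH = Suc.IH[OF this]
    have aq: "0 \<le> a * q ^ Suc j" using \<open>0 \<le> a\<close> q by simp
    show ?case
    proof (cases "even k")
      case True
      then have "real k / 2 ^ Suc j = real m / 2 ^ j"
        by (auto simp: m_def elim!: evenE)
      then show ?thesis using IH aq by (simp add: distrib_left)
    next
      case False
      then have k: "k = Suc (2 * m)" by (simp add: m_def)
      have "norm (w (real k / 2 ^ Suc j) - w (real (2 * m) / 2 ^ Suc j)) \<le> a * q ^ Suc j"
        using incr[of "2 * m" "Suc j"] Suc.prems unfolding k by simp
      moreover have "real (2 * m) / 2 ^ Suc j = real m / 2 ^ j" by simp
      ultimately have "norm (w (real k / 2 ^ Suc j) - w (real m / 2 ^ j)) \<le> a * q ^ Suc j" by metis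
      then show ?thesis
        using IH norm_triangle_ineq[of "w (real k / 2 ^ Suc j) - w (real m / 2 ^ j)" "w (real m / 2 ^ j) - w 0"]
        by (simp add: distrib_left)
    qed
  qed
  have geometric: "a * (\<Sum>i\<le>j. q ^ i) \<le> a / (1 - q)" for j
  proof -
    have "(\<Sum>i\<le>j. q ^ i) \<le> 1 / (1 - q)"
      using q by (simp add: sum_gp0 divide_right_mono)
    then show ?thesis using mult_left_mono[OF _ \<open>0 \<le> a\<close>] by fastforce
  qed
  \<comment> \<open>A general time is the limit of its dyadic truncations.\<close>
  define k where "k j = nat \<lfloor>s * 2 ^ j\<rfloor>" for j
  have k_le: "real (k j) \<le> s * 2 ^ j" "s * 2 ^ j - 1 \<le> real (k j)" for j
    using s by (auto simp: k_def of_nat_nat)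
  have "k j \<le> 2 ^ j" for j
  proof -
    have "s * 2 ^ j \<le> 2 ^ j" using s by simp
    then have "real (k j) \<le> real (2 ^ j)"
      using k_le(1)[of j] unfolding of_nat_power of_nat_numeral by linarith
    then show ?thesis by (simp only: of_nat_le_iff)
  qed
  then have bound: "norm (w (real (k j) / 2 ^ j) - w 0) \<le> a / (1 - q)" for j
    using dyadic geometric order_trans by blast
  have mem: "real (k j) / 2 ^ j \<in> {0..1}" for j
    using \<open>k j \<le> 2 ^ j\<close> by (simp add: divide_le_eq)
  have "(\<lambda>j. real (k j) / 2 ^ j) \<longlonglongrightarrow> s"
  proof (rule real_tendsto_sandwich)
    show "\<forall>\<^sub>F j in sequentially. s - (1 / 2) ^ j \<le> real (k j) / 2 ^ j"
    proof (intro always_eventually allI)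
      fix j
      have "s - (1 / 2) ^ j = (s * 2 ^ j - 1) / 2 ^ j" by (simp add: field_simps)
      then show "s - (1 / 2) ^ j \<le> real (k j) / 2 ^ j"
        using divide_right_mono[OF k_le(2), of "2 ^ j" j] by simp
    qed
    show "\<forall>\<^sub>F j in sequentially. real (k j) / 2 ^ j \<le> s"
      using k_le(1) by (intro always_eventually allI) (simp add: field_simps)
    show "(\<lambda>j. s - (1 / 2) ^ j) \<longlonglongrightarrow> s"
      using tendsto_diff[OF tendsto_const LIMSEQ_power_zero[of "1 / 2 :: real"], of s] by simp
  qed simp
  then have "(\<lambda>j. w (real (k j) / 2 ^ j)) \<longlonglongrightarrow> w s"
    using continuous_on_tendsto_compose[OF cont, where F = sequentially] s mem
    by (simp add: always_eventually del: atLeastAtMost_iff)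
  then have "(\<lambda>j. norm (w (real (k j) / 2 ^ j) - w 0)) \<longlonglongrightarrow> norm (w s - w 0)"
    by (intro tendsto_intros)
  then show ?thesis
    by (rule LIMSEQ_le_const2) (use bound in blast)
qed

context prob_space
begin

text \<open>
  Stated with an exceptional event instead of a supremum over a real interval, whose measurability would
  have to be proved separately.
\<close>

lemma brownian_oscillation:
  fixes W :: "real \<Rightarrow> 'a \<Rightarrow> real ^ 'n"
  assumes W: "standard_brownian_motion W" and u: "0 \<le> u" and h: "0 < h" and a: "0 < a"
  obtains B where "B \<in> events" "prob B \<le> 160 * sqrt 2 ^ CARD('n) * (h\<^sup>2 / a ^ 4)"
    "\<And>\<omega> s. \<omega> \<in> space M - B \<Longrightarrow> s \<in> {u..u + h} \<Longrightarrow> norm (W s \<omega> - W u \<omega>) \<le> 10 * a"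
proof
  \<comment> \<open>The thresholds \<open>a * q ^ j\<close> must be summable, and the failure probabilities, which are of order
    \<open>(1 / (2 * q ^ 4)) ^ j\<close>, as well; any \<open>q\<close> with \<open>1 / 2 < q ^ 4 < 1\<close> would do. With \<open>q = 9 / 10\<close>
    the two sums are \<open>10 * a\<close> and less than \<open>5\<close> times the first term.\<close>
  define q :: real where "q = 9 / 10"
  define p where "p j k = u + h * (real k / 2 ^ j)" for j k :: nat
  have p: "0 \<le> p j k" "p j k < p j (Suc k)" "p j (Suc k) - p j k = h / 2 ^ j" for j k
    using u h by (auto simp: p_def field_simps)
  define A where "A j k = {\<omega> \<in> space M. a * q ^ j < norm (W (p j (Suc k)) \<omega> - W (p j k) \<omega>)}" for j k
  define B where "B j = (\<Union>k<2 ^ j. A j k)" for j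
  have [measurable]: "random_variable borel (W (p j k))" for j k
    using W p(1) by (rule brownian_measurable)
  have A: "A j k \<in> events" for j k
    unfolding A_def by measurable
  then have B: "B j \<in> events" for j
    by (auto simp: B_def)
  define C where "C = 32 * sqrt 2 ^ CARD('n) * (h\<^sup>2 / a ^ 4)"
  define x :: real where "x = 5000 / 6561"
  have prob_B: "prob (B j) \<le> C * x ^ j" for j
  proof -
    have "prob (B j) \<le> (\<Sum>k<2 ^ j. prob (A j k))"
      unfolding B_def using A by (intro finite_measure_subadditive_finite) auto
    also have "\<dots> \<le> (\<Sum>k<(2::nat) ^ j. 32 * sqrt 2 ^ CARD('n) * ((h / 2 ^ j)\<^sup>2 / (a * q ^ j) ^ 4))"
      unfolding A_def using brownian_tail_power[OF W p(1,2), of "a * q ^ _"] a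
      by (intro sum_mono) (simp add: p(3) q_def)
    also have "\<dots> = C * (2 ^ j * ((1 / 2 ^ j)\<^sup>2 / (q ^ j) ^ 4))"
      by (simp add: C_def power_mult_distrib power_divide mult_ac)
    also have "2 ^ j * ((1 / 2 ^ j)\<^sup>2 / (q ^ j) ^ 4) = (2 * ((1 / 2)\<^sup>2 / q ^ 4)) ^ j"
      by (simp add: power_mult_distrib power_divide power_mult[symmetric] mult.commute power2_eq_square)
    also have "2 * ((1 / 2)\<^sup>2 / q ^ 4) = x"
      by (simp add: x_def q_def power2_eq_square eval_nat_numeral)
    finally show ?thesis .
  qed
  have x: "norm x < 1" by (simp add: x_def)
  have C: "0 \<le> C" by (simp add: C_def)
  have summable: "summable (\<lambda>j. C * x ^ j)"
    using x by (intro summable_mult summable_geometric)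
  then have summable_B: "summable (\<lambda>j. prob (B j))"
    by (rule summable_comparison_test') (use prob_B in auto)
  show "(\<Union>j. B j) \<in> events" using B by auto
  have "prob (\<Union>j. B j) \<le> (\<Sum>j. prob (B j))"
    using B summable_B by (intro finite_measure_subadditive_countably) auto
  also have "\<dots> \<le> (\<Sum>j. C * x ^ j)"
    by (rule suminf_le[OF prob_B summable_B summable])
  also have "\<dots> = C * (1 / (1 - x))"
    using x by (simp add: suminf_mult suminf_geometric summable_geometric)
  also have "\<dots> \<le> C * 5"
    using C by (intro mult_left_mono) (auto simp: x_def)
  finally show "prob (\<Union>j. B j) \<le> 160 * sqrt 2 ^ CARD('n) * (h\<^sup>2 / a ^ 4)"
    by (simp add: C_def)
  fix \<omega> s assume \<omega>: "\<omega> \<in> space M - (\<Union>j. B j)" and s: "s \<in> {u..u + h}"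
  define w where "w y = W (u + h * y) \<omega>" for y
  have "continuous_on {0..} (\<lambda>t. W t \<omega>)"
    using brownian_continuous[OF W] \<omega> by blast
  then have "continuous_on {0..1} w"
    unfolding w_def using u h by (elim continuous_on_compose2) (auto intro!: continuous_on_add continuous_on_mult continuous_on_const continuous_on_id)
  moreover have "norm (w (real (Suc k) / 2 ^ j) - w (real k / 2 ^ j)) \<le> a * q ^ j" if "k < 2 ^ j" for j k
  proof -
    have "\<omega> \<notin> A j k" using \<omega> that unfolding B_def by blast
    then have "norm (W (p j (Suc k)) \<omega> - W (p j k) \<omega>) \<le> a * q ^ j"
      using \<omega> unfolding A_def by (simp add: not_less)
    then show ?thesis by (simp only: p_def w_def)
  qed
  ultimately have "norm (w ((s - u) / h) - w 0) \<le> a / (1 - q)"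
    using s h a by (intro dyadic_chain) (auto simp: q_def)
  then show "norm (W s \<omega> - W u \<omega>) \<le> 10 * a"
    using h by (simp add: w_def q_def)
qed

end

text \<open>
  A lower bound for the probability that a centred normal variable of standard deviation \<open>\<sigma>\<close> lies in
  \<open>[0, \<sigma> / 4]\<close>: the length of the interval times the density at its right end. It does not depend on
  \<open>\<sigma>\<close>.
\<close>

definition box_const :: real where
  "box_const = exp (- 1 / 32) / (4 * sqrt (2 * pi))"

lemma box_const_pos: "0 < box_const"
  by (simp add: box_const_def)

lemma box_const_le_1: "box_const \<le> 1"
proof -
  have "1 \<le> sqrt (2 * pi)" using pi_ge_two by simp
  then have "exp (- 1 / 32) \<le> 4 * sqrt (2 * pi)"
    using exp_le_one_iff[of "- 1 / 32"] by linarith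
  then show ?thesis using pi_gt_zero by (simp add: box_const_def divide_le_eq)
qed

context prob_space
begin

text \<open>
  A box that contains, in each coordinate, half a unit to one side of the origin is hit with a
  probability that does not degenerate as \<open>t\<close> tends to \<open>0\<close>. The intervals are half-open because the
  cells below are.
\<close>

lemma brownian_box:
  fixes W :: "real \<Rightarrow> 'a \<Rightarrow> real ^ 'n" and lo hi :: "'n \<Rightarrow> real"
  assumes W: "standard_brownian_motion W" and t: "0 < t" "t \<le> 1"
    and box: "\<And>i. lo i \<le> 0 \<and> 1 / 2 \<le> hi i \<or> lo i \<le> - 1 / 2 \<and> 0 < hi i"
  shows "box_const ^ CARD('n) \<le> prob {\<omega> \<in> space M. \<forall>i. lo i \<le> W t \<omega> $ i \<and> W t \<omega> $ i < hi i}"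
proof -
  \<comment> \<open>In every coordinate, \<open>[0, b]\<close> or \<open>[- b, 0]\<close> lies in the half-open interval, because
    \<open>b \<le> 1 / 4\<close>. On the box formed by these intervals the density is at least its value \<open>m\<close> at
    the corners away from the origin.\<close>
  define b where "b = sqrt t / 4"
  have b: "0 < b" "b \<le> 1 / 4" "b\<^sup>2 = t / 16" using t by (simp_all add: b_def power_divide)
  define l :: "real ^ 'n" where "l = (\<chi> i. if lo i \<le> 0 \<and> 1 / 2 \<le> hi i then 0 else - b)"
  define r :: "real ^ 'n" where "r = (\<chi> i. l $ i + b)"
  define g where "g x = (\<Prod>i\<in>UNIV. normal_density 0 (sqrt t) (x $ i))" for x :: "real ^ 'n"
  have [measurable]: "random_variable borel (W t)" using W t by (simp add: brownian_measurable)
  have D: "distributed M lborel (W t) (\<lambda>x. ennreal (g x))"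
  proof -
    have "\<And>\<omega>. \<omega> \<in> space M \<Longrightarrow> W t \<omega> - W 0 \<omega> = W t \<omega>"
      using brownian_start[OF W] by simp
    then have "distr M lborel (\<lambda>\<omega>. W t \<omega> - W 0 \<omega>) = distr M lborel (W t)"
      by (intro distr_cong) auto
    moreover have "distributed M lborel (\<lambda>\<omega>. W t \<omega> - W 0 \<omega>) (\<lambda>x. ennreal (g x))"
      using brownian_increment[OF W, of 0 t] t by (simp only: g_def diff_zero order_refl simp_thms)
    ultimately show ?thesis
      unfolding distributed_def by simp
  qed
  define m where "m = (1 / sqrt (2 * pi * t)) ^ CARD('n) * exp (- (real CARD('n) * (1 / 32)))"
  have m: "0 \<le> m" using t by (simp add: m_def)
  have cbox: "lo i \<le> x $ i" "x $ i < hi i" "\<bar>x $ i\<bar> \<le> b" if "x \<in> cbox l r" for x i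
    using that box[of i] b unfolding mem_box_cart l_def r_def
    by (auto dest!: spec[of _ i] split: if_splits)
  have m_le: "m \<le> g x" if x: "x \<in> cbox l r" for x
  proof -
    have "(norm x)\<^sup>2 = (\<Sum>i\<in>UNIV. (x $ i)\<^sup>2)"
      by (simp add: power2_norm_eq_inner inner_vec_def power2_eq_square[of "x $ _"])
    also have "\<dots> \<le> (\<Sum>i\<in>(UNIV::'n set). b\<^sup>2)"
      using cbox(3)[OF x] b by (intro sum_mono) (metis abs_ge_zero power2_abs power_mono)
    finally have "(norm x)\<^sup>2 \<le> real CARD('n) * (t / 16)" by (simp add: b)
    then have "(norm x)\<^sup>2 / (2 * t) \<le> real CARD('n) * (1 / 32)"
      using t by (simp add: field_simps)
    then show ?thesis
      using t unfolding m_def g_def gauss_density[OF t(1)] by (intro mult_left_mono) auto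
  qed
  have lr: "l \<bullet> i \<le> r \<bullet> i" if "i \<in> Basis" for i
    using that b by (auto simp: Basis_vec_def r_def inner_axis)
  have "measure lborel (cbox l r) = (\<Prod>i\<in>(UNIV::'n set). b)"
    using b by (subst content_cbox_cart) (auto simp: r_def interval_ne_empty_cart)
  then have vol: "emeasure lborel (cbox l r) = ennreal (b ^ CARD('n))"
    using emeasure_lborel_cbox_finite[of l r] by (subst emeasure_eq_ennreal_measure) auto
  have const: "box_const = 1 / sqrt (2 * pi * t) * exp (- (1 / 32)) * b"
    using t by (simp add: box_const_def b_def real_sqrt_mult)
  have "exp (- (real CARD('n) * (1 / 32))) = exp (- (1 / 32)) ^ CARD('n)"
    by (simp add: exp_of_nat_mult[symmetric])
  then have "box_const ^ CARD('n) = m * b ^ CARD('n)"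
    unfolding const m_def power_mult_distrib by simp
  then have "ennreal (box_const ^ CARD('n)) = ennreal m * emeasure lborel (cbox l r)"
    using m b by (simp add: vol ennreal_mult')
  also have "\<dots> = (\<integral>\<^sup>+x. ennreal m * indicator (cbox l r) x \<partial>lborel)"
    by (simp add: nn_integral_cmult_indicator)
  also have "\<dots> \<le> (\<integral>\<^sup>+x. ennreal (g x) * indicator (cbox l r) x \<partial>lborel)"
    using m_le by (intro nn_integral_mono) (auto simp: indicator_def intro!: ennreal_leI)
  also have "\<dots> = emeasure M (W t -` cbox l r \<inter> space M)"
    using distributed_emeasure[OF D, of "cbox l r"] by simp
  also have "\<dots> \<le> emeasure M {\<omega> \<in> space M. \<forall>i. lo i \<le> W t \<omega> $ i \<and> W t \<omega> $ i < hi i}"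
  proof (rule emeasure_mono)
    show "{\<omega> \<in> space M. \<forall>i. lo i \<le> W t \<omega> $ i \<and> W t \<omega> $ i < hi i} \<in> events"
      by measurable
  qed (use cbox in auto)
  finally show ?thesis
    by (simp add: emeasure_eq_measure)
qed

end

section \<open>Poisson counts\<close>

context prob_space
begin

lemma poisson_points_measurable:
  assumes "poisson_process \<rho> Y"
  shows "random_variable borel (Y i)"
proof -
  have "\<forall>i. random_variable borel (Y i)"
    using assms unfolding poisson_process_def by (elim conjE)
  then show ?thesis ..
qed

lemma poisson_finite:
  assumes "poisson_process \<rho> Y" and \<omega>: "\<omega> \<in> space M" and A: "bounded A"
  shows "finite {i. Y i \<omega> \<in> A}"
proof -
  have "\<forall>\<omega>\<in>space M. \<forall>A. bounded A \<longrightarrow> finite {i. Y i \<omega> \<in> A}"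
    using assms(1) unfolding poisson_process_def by (elim conjE)
  from this[rule_format, OF \<omega> A] show ?thesis .
qed

lemma poisson_indep:
  fixes m :: nat
  assumes P: "poisson_process \<rho> Y" and A: "\<And>j. j < m \<Longrightarrow> A j \<in> sets borel \<and> bounded (A j)"
    and disj: "disjoint_family_on A {..<m}"
  shows "indep_vars (\<lambda>_. count_space UNIV) (\<lambda>j. point_count Y (A j)) {..<m}"
proof -
  have "\<forall>A m. (\<forall>j<m. A j \<in> sets borel \<and> bounded (A j)) \<longrightarrow> disjoint_family_on A {..<m} \<longrightarrow>
      indep_vars (\<lambda>_. count_space UNIV) (\<lambda>j. point_count Y (A j)) {..<m :: nat}"
    using P unfolding poisson_process_def by (elim conjE)
  then show ?thesis using A disj by simp
qed

lemma poisson_mass: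
  assumes "poisson_process \<rho> Y" and A: "A \<in> sets borel" "bounded A"
  shows "prob {\<omega> \<in> space M. point_count Y A \<omega> = k} =
    exp (- (\<rho> * measure lborel A)) * (\<rho> * measure lborel A) ^ k / fact k"
proof -
  have "\<forall>A\<in>sets borel. bounded A \<longrightarrow> (\<forall>k. prob {\<omega> \<in> space M. point_count Y A \<omega> = k} =
      exp (- (\<rho> * measure lborel A)) * (\<rho> * measure lborel A) ^ k / fact k)"
    using assms(1) unfolding poisson_process_def by (elim conjE)
  from this[rule_format, OF A] show ?thesis .
qed

lemma point_count_measurable:
  assumes "poisson_process \<rho> Y" "A \<in> sets borel" "bounded A"
  shows "random_variable (count_space UNIV) (point_count Y A)"
  using poisson_indep[OF assms(1), of 1 "\<lambda>_. A"] assms(2,3)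
  by (auto simp: indep_vars_def disjoint_family_on_def)

text \<open>
  With \<open>q \<le> 1\<close> this gives the probability that no point survives a thinning with retention probability
  \<open>1 - q\<close>; with \<open>q = 2\<close> it gives the tail bound below.
\<close>

lemma poisson_generating_function:
  assumes P: "poisson_process \<rho> Y" and A: "A \<in> sets borel" "bounded A" and "0 \<le> \<rho>" "0 \<le> q"
  shows "(\<integral>\<^sup>+\<omega>. ennreal (q ^ point_count Y A \<omega>) \<partial>M) = ennreal (exp (\<rho> * measure lborel A * (q - 1)))"
proof -
  define l where "l = \<rho> * measure lborel A"
  have l: "0 \<le> l" using \<open>0 \<le> \<rho>\<close> by (simp add: l_def)
  define E where "E k = {\<omega> \<in> space M. point_count Y A \<omega> = k}" for k
  have [measurable]: "random_variable (count_space UNIV) (point_count Y A)"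
    by (rule point_count_measurable[OF P A])
  have E [measurable]: "E k \<in> events" for k unfolding E_def by measurable
  have "disjoint_family E" by (auto simp: E_def disjoint_family_on_def)
  then have "(\<integral>\<^sup>+\<omega>. ennreal (q ^ point_count Y A \<omega>) \<partial>M) =
      (\<integral>\<^sup>+\<omega>. (\<Sum>k. ennreal (q ^ k) * indicator (E k) \<omega>) \<partial>M)"
    by (intro nn_integral_cong) (subst suminf_cmult_indicator, auto simp: E_def)
  also have "\<dots> = (\<Sum>k. ennreal (q ^ k) * emeasure M (E k))"
    by (subst nn_integral_suminf) (auto simp: nn_integral_cmult_indicator)
  also have "\<dots> = (\<Sum>k. ennreal (exp (- l) * ((q * l) ^ k /\<^sub>R fact k)))"
    using poisson_mass[OF P A] l \<open>0 \<le> q\<close>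
    by (intro suminf_cong)
       (simp add: E_def emeasure_eq_measure l_def[symmetric] ennreal_mult[symmetric] power_mult_distrib divide_inverse mult_ac)
  also have "\<dots> = ennreal (\<Sum>k. exp (- l) * ((q * l) ^ k /\<^sub>R fact k))"
    using l \<open>0 \<le> q\<close> by (intro suminf_ennreal2 summable_mult summable_exp_generic) auto
  also have "(\<Sum>k. exp (- l) * ((q * l) ^ k /\<^sub>R fact k)) = exp (- l) * exp (q * l)"
    by (subst suminf_mult[OF summable_exp_generic]) (simp add: exp_def)
  also have "\<dots> = exp (l * (q - 1))"
    by (simp add: exp_add[symmetric] algebra_simps)
  finally show ?thesis by (simp add: l_def)
qed

lemma poisson_tail:
  assumes P: "poisson_process \<rho> Y" and A: "A \<in> sets borel" "bounded A" and "0 \<le> \<rho>"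
  shows "prob {\<omega> \<in> space M. k \<le> point_count Y A \<omega>} \<le> exp (\<rho> * measure lborel A) / 2 ^ k"
proof -
  have [measurable]: "random_variable (count_space UNIV) (point_count Y A)"
    by (rule point_count_measurable[OF P A])
  have "ennreal (2 ^ k) * emeasure M {\<omega> \<in> space M. k \<le> point_count Y A \<omega>} =
      (\<integral>\<^sup>+\<omega>. ennreal (2 ^ k) * indicator {\<omega> \<in> space M. k \<le> point_count Y A \<omega>} \<omega> \<partial>M)"
    by (rule nn_integral_cmult_indicator[symmetric]) measurable
  also have "\<dots> \<le> (\<integral>\<^sup>+\<omega>. ennreal (2 ^ point_count Y A \<omega>) \<partial>M)"
    by (intro nn_integral_mono) (auto simp: indicator_def intro!: ennreal_leI power_increasing)
  also have "\<dots> = ennreal (exp (\<rho> * measure lborel A))"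
    using poisson_generating_function[OF P A \<open>0 \<le> \<rho>\<close>, of 2] by simp
  finally show ?thesis
    by (simp add: emeasure_eq_measure ennreal_mult[symmetric] field_simps)
qed

end

section \<open>Coverage by moving discs\<close>

text \<open>
  The disc is horizontal, so translating it along a trajectory does not change the time.
\<close>

lemma mem_trajectory_plus_disc:
  fixes f :: "real \<Rightarrow> real ^ 'n"
  assumes "0 \<le> r"
  shows "(x, t) \<in> trajectory f + (*\<^sub>R) r ` (cball 0 1 \<times> {0}) \<longleftrightarrow> 0 \<le> t \<and> dist x (f t) \<le> r"
proof
  assume "(x, t) \<in> trajectory f + (*\<^sub>R) r ` (cball 0 1 \<times> {0})"
  then have "\<exists>u. 0 \<le> t \<and> x = f t + r *\<^sub>R u \<and> norm u \<le> 1"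
    by (auto simp: trajectory_def set_plus_def)
  then obtain u where "0 \<le> t" "x = f t + r *\<^sub>R u" "norm u \<le> 1"
    by blast
  then show "0 \<le> t \<and> dist x (f t) \<le> r"
    using assms mult_left_mono[of "norm u" 1 r] by (simp add: dist_norm)
next
  assume *: "0 \<le> t \<and> dist x (f t) \<le> r"
  define u where "u = inverse r *\<^sub>R (x - f t)"
  have "norm u \<le> 1"
    using * assms by (cases "r = 0") (simp_all add: u_def dist_norm divide_simps)
  moreover have "x - f t = r *\<^sub>R u"
    using * by (cases "r = 0") (auto simp: u_def)
  then have "x = f t + r *\<^sub>R u"
    by (simp add: algebra_simps)
  ultimately show "(x, t) \<in> trajectory f + (*\<^sub>R) r ` (cball 0 1 \<times> {0})"
    using * unfolding trajectory_def set_plus_def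
    by (auto intro!: bexI[of _ "(r *\<^sub>R u, 0)"] image_eqI[of _ _ "(u, 0)"])
qed

lemma covered_iff:
  fixes Y :: "real \<Rightarrow> nat \<Rightarrow> 'w \<Rightarrow> real ^ 'n"
  assumes "0 \<le> r"
  shows "cbox 0 1 \<times> {0..1} \<subseteq> cylinder_union Y W \<rho> ((*\<^sub>R) r ` (cball 0 1 \<times> {0})) \<omega> \<longleftrightarrow>
    (\<forall>x\<in>cbox 0 1. \<forall>t\<in>{0..1}. \<exists>i<point_count (Y \<rho>) (cbox 0 1) \<omega>. dist x (Y \<rho> i \<omega> + W \<rho> i t \<omega>) \<le> r)"
  unfolding cylinder_union_def by (force simp: mem_trajectory_plus_disc[OF assms])

lemma closed_covered:
  fixes f :: "nat \<Rightarrow> real \<Rightarrow> real ^ 'n"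
  assumes "\<And>i. continuous_on {0..} (f i)"
  shows "closed {p \<in> cbox 0 1 \<times> {0..1}. \<exists>i<N. dist (fst p) (f i (snd p)) \<le> r}"
proof -
  have "closed {p \<in> cbox 0 1 \<times> {0..1}. dist (fst p) (f i (snd p)) \<le> r}" for i
    by (intro continuous_on_closed_Collect_le continuous_intros closed_Times
        continuous_on_compose2[OF assms[of i]]) auto
  then have "closed (\<Union>i<N. {p \<in> cbox 0 1 \<times> {0..1}. dist (fst p) (f i (snd p)) \<le> r})"
    by (intro closed_UN) auto
  then show ?thesis
    by (rule back_subst[of closed]) auto
qed

context generalized_cylinder_model
begin

abbreviation num_points :: "real \<Rightarrow> 'w \<Rightarrow> nat" where
  "num_points \<rho> \<equiv> point_count (Y \<rho>) (cbox 0 1)"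

definition covered :: "real \<Rightarrow> real \<Rightarrow> 'w \<Rightarrow> bool" where
  "covered \<rho> r \<omega> \<longleftrightarrow>
    (\<forall>x\<in>cbox 0 1. \<forall>t\<in>{0..1}. \<exists>i<num_points \<rho> \<omega>. dist x (Y \<rho> i \<omega> + W \<rho> i t \<omega>) \<le> r)"

abbreviation radius :: "real \<Rightarrow> 'w \<Rightarrow> ereal" where
  "radius \<rho> \<equiv> coverage_radius Y W \<rho> (cball 0 1 \<times> {0})"

lemma radius_eq: "radius \<rho> \<omega> = Inf {ereal r | r. 0 \<le> r \<and> covered \<rho> r \<omega>}"
  unfolding coverage_radius_def covered_def
  by (rule arg_cong[of _ _ Inf]) (auto simp: covered_iff)

lemma radius_le: "0 \<le> r \<Longrightarrow> covered \<rho> r \<omega> \<Longrightarrow> radius \<rho> \<omega> \<le> ereal r"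
  unfolding radius_eq by (rule Inf_lower) auto

lemma radius_ge: "(\<And>r. 0 \<le> r \<Longrightarrow> covered \<rho> r \<omega> \<Longrightarrow> b \<le> r) \<Longrightarrow> ereal b \<le> radius \<rho> \<omega>"
  unfolding radius_eq by (rule Inf_greatest) auto

lemma covered_mono: "covered \<rho> r \<omega> \<Longrightarrow> r \<le> r' \<Longrightarrow> covered \<rho> r' \<omega>"
  unfolding covered_def by (meson order_trans)

text \<open>
  Coverage is a condition on uncountably many pairs of a place and a time. The covered pairs form a closed
  set, since finitely many continuous trajectories are involved, so a countable dense set of pairs
  suffices.
\<close>

lemma covered_event:
  assumes \<rho>: "0 < \<rho>"
  shows "{\<omega> \<in> space M. covered \<rho> r \<omega>} \<in> events"
proof -
  obtain D :: "((real ^ 'n) \<times> real) set"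
    where D: "countable D" "D \<subseteq> cbox 0 1 \<times> {0..1}" "cbox 0 1 \<times> {0..1} \<subseteq> closure D"
    by (rule separable)
  have dense: "covered \<rho> r \<omega> \<longleftrightarrow>
      (\<forall>p\<in>D. \<exists>i<num_points \<rho> \<omega>. dist (fst p) (Y \<rho> i \<omega> + W \<rho> i (snd p) \<omega>) \<le> r)"
    if \<omega>: "\<omega> \<in> space M" for \<omega>
  proof
    assume "covered \<rho> r \<omega>"
    then show "\<forall>p\<in>D. \<exists>i<num_points \<rho> \<omega>. dist (fst p) (Y \<rho> i \<omega> + W \<rho> i (snd p) \<omega>) \<le> r"
      using D(2) unfolding covered_def by (auto simp: subset_iff)
  next
    define S where "S = {p \<in> cbox 0 1 \<times> {0..1}. \<exists>i<num_points \<rho> \<omega>. dist (fst p) (Y \<rho> i \<omega> + W \<rho> i (snd p) \<omega>) \<le> r}"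
    assume "\<forall>p\<in>D. \<exists>i<num_points \<rho> \<omega>. dist (fst p) (Y \<rho> i \<omega> + W \<rho> i (snd p) \<omega>) \<le> r"
    then have "D \<subseteq> S" using D(2) by (auto simp: S_def)
    moreover have "closed S"
      unfolding S_def using brownian_continuous[OF brownian[OF \<rho>] \<omega>]
      by (intro closed_covered[of "\<lambda>i t. Y \<rho> i \<omega> + W \<rho> i t \<omega>"] continuous_on_add continuous_on_const) auto
    ultimately have "closure D \<subseteq> S" by (rule closure_minimal)
    with D(3) have "cbox 0 1 \<times> {0..1} \<subseteq> S" by (rule subset_trans)
    then show "covered \<rho> r \<omega>" unfolding covered_def S_def by force
  qed
  have [measurable]: "random_variable (count_space UNIV) (num_points \<rho>)"
    by (rule point_count_measurable[OF poisson[OF \<rho>]]) simp_all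
  have [measurable]: "random_variable borel (Y \<rho> i)" for i
    by (rule poisson_points_measurable[OF poisson[OF \<rho>]])
  have "{\<omega> \<in> space M. \<forall>p\<in>D. \<exists>i<num_points \<rho> \<omega>. dist (fst p) (Y \<rho> i \<omega> + W \<rho> i (snd p) \<omega>) \<le> r} \<in> events"
  proof (rule sets.sets_Collect_countable_All'[OF _ D(1)])
    fix p assume "p \<in> D"
    then have "0 \<le> snd p" using D(2) by auto
    then have [measurable]: "random_variable borel (W \<rho> i (snd p))" for i
      by (rule brownian_measurable[OF brownian[OF \<rho>]])
    have "{\<omega> \<in> space M. \<exists>i. i < num_points \<rho> \<omega> \<and> dist (fst p) (Y \<rho> i \<omega> + W \<rho> i (snd p) \<omega>) \<le> r} \<in> events"
      by measurable
    then show "{\<omega> \<in> space M. \<exists>i<num_points \<rho> \<omega>. dist (fst p) (Y \<rho> i \<omega> + W \<rho> i (snd p) \<omega>) \<le> r} \<in> events"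
      by simp
  qed
  then show ?thesis
    by (rule back_subst[of "\<lambda>A. A \<in> events"]) (use dense in auto)
qed

text \<open>
  Without measurability the probability in the theorem would be the default value \<open>0\<close> of
  \<^const>\<open>measure\<close>, and bounds for the complement would say nothing about it.
\<close>

lemma radius_measurable:
  assumes "0 < \<rho>"
  shows "radius \<rho> \<in> borel_measurable M"
proof (rule borel_measurableI_less)
  fix y
  have "{\<omega> \<in> space M. radius \<rho> \<omega> < y} =
      (\<Union>q\<in>{q \<in> \<rat>. 0 \<le> q \<and> ereal q < y}. {\<omega> \<in> space M. covered \<rho> q \<omega>})"
  proof (intro set_eqI iffI)
    fix \<omega> assume "\<omega> \<in> {\<omega> \<in> space M. radius \<rho> \<omega> < y}"
    then obtain r where r: "\<omega> \<in> space M" "0 \<le> r" "covered \<rho> r \<omega>" "ereal r < y"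
      unfolding radius_eq Inf_less_iff by blast
    obtain z where "ereal r < ereal z" "ereal z < y"
      using r(4) by (metis ereal_dense2)
    moreover obtain q where "q \<in> \<rat>" "r < q" "q < z"
      using \<open>ereal r < ereal z\<close> Rats_dense_in_real[of r z] by auto
    ultimately have "ereal q < y" "0 \<le> q" "covered \<rho> q \<omega>"
      using r(2) covered_mono[OF r(3)] by (auto intro: less_trans[of "ereal q" "ereal z" y])
    then show "\<omega> \<in> (\<Union>q\<in>{q \<in> \<rat>. 0 \<le> q \<and> ereal q < y}. {\<omega> \<in> space M. covered \<rho> q \<omega>})"
      using r(1) \<open>q \<in> \<rat>\<close> by blast
  next
    fix \<omega> assume "\<omega> \<in> (\<Union>q\<in>{q \<in> \<rat>. 0 \<le> q \<and> ereal q < y}. {\<omega> \<in> space M. covered \<rho> q \<omega>})"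
    then show "\<omega> \<in> {\<omega> \<in> space M. radius \<rho> \<omega> < y}"
      using radius_le le_less_trans by blast
  qed
  moreover have "countable {q \<in> \<rat>. 0 \<le> q \<and> ereal q < y}"
    by (rule countable_subset[OF _ countable_rat]) auto
  ultimately show "{\<omega> \<in> space M. radius \<rho> \<omega> < y} \<in> events"
    using covered_event[OF assms] by (auto intro!: sets.countable_UN')
qed

end

section \<open>Points that are not transferred into given sets\<close>

context prob_space
begin

text \<open>
  Fubini for independent variables: one of them may be frozen while the probability is computed with the
  other.
\<close>

lemma emeasure_indep_section:
  assumes XZ: "indep_var S X T Z" and E: "E \<in> sets (S \<Otimes>\<^sub>M T)"
  shows "emeasure M {\<omega> \<in> space M. (X \<omega>, Z \<omega>) \<in> E} =
    (\<integral>\<^sup>+\<omega>. emeasure M {\<omega>' \<in> space M. (X \<omega>, Z \<omega>') \<in> E} \<partial>M)"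
proof -
  have X [measurable]: "random_variable S X" and Z [measurable]: "random_variable T Z"
    and prod: "distr M S X \<Otimes>\<^sub>M distr M T Z = distr M (S \<Otimes>\<^sub>M T) (\<lambda>\<omega>. (X \<omega>, Z \<omega>))"
    using XZ unfolding indep_var_distribution_eq by auto
  interpret Z: prob_space "distr M T Z" by (rule prob_space_distr) (rule Z)
  have section_sets: "Pair x -` E \<in> sets T" for x
    using E by (rule sets_Pair1)
  have "emeasure M {\<omega> \<in> space M. (X \<omega>, Z \<omega>) \<in> E} = emeasure (distr M (S \<Otimes>\<^sub>M T) (\<lambda>\<omega>. (X \<omega>, Z \<omega>))) E"
    using E by (subst emeasure_distr) (auto simp: vimage_def Int_def conj_commute)
  also have "\<dots> = (\<integral>\<^sup>+x. emeasure (distr M T Z) (Pair x -` E) \<partial>distr M S X)"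
    unfolding prod[symmetric] using E by (subst Z.emeasure_pair_measure_alt) (auto cong: sets_pair_measure_cong)
  also have "\<dots> = (\<integral>\<^sup>+\<omega>. emeasure (distr M T Z) (Pair (X \<omega>) -` E) \<partial>M)"
  proof (rule nn_integral_distr[OF X])
    show "(\<lambda>x. emeasure (distr M T Z) (Pair x -` E)) \<in> borel_measurable (distr M S X)"
      using E by (intro Z.measurable_emeasure_Pair) (simp cong: sets_pair_measure_cong)
  qed
  also have "\<dots> = (\<integral>\<^sup>+\<omega>. emeasure M {\<omega>' \<in> space M. (X \<omega>, Z \<omega>') \<in> E} \<partial>M)"
    by (intro nn_integral_cong, subst emeasure_distr[OF Z section_sets])
       (auto simp: vimage_def Int_def conj_commute)
  finally show ?thesis .
qed

lemma prob_indep_finite: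
  assumes X: "indep_vars (\<lambda>_. N) X UNIV" and "finite I" and A: "\<And>i. A i \<in> sets N"
  shows "prob {\<omega> \<in> space M. \<forall>i\<in>I. X i \<omega> \<in> A i} = (\<Prod>i\<in>I. prob {\<omega> \<in> space M. X i \<omega> \<in> A i})"
proof (cases "I = {}")
  case False
  have "{\<omega> \<in> space M. \<forall>i\<in>I. X i \<omega> \<in> A i} = (\<Inter>i\<in>I. X i -` A i \<inter> space M)"
    using False by auto
  moreover have "{\<omega> \<in> space M. X i \<omega> \<in> A i} = X i -` A i \<inter> space M" for i by auto
  ultimately show ?thesis
    using indep_varsD[OF X False \<open>finite I\<close>, of A] A by simp
qed (simp add: prob_space)

end

context generalized_cylinder_model
begin

lemma indep_points_positions:
  assumes \<rho>: "0 < \<rho>" and t: "0 \<le> t"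
  shows "indep_var (\<Pi>\<^sub>M i\<in>UNIV. borel) (\<lambda>\<omega> i. Y \<rho> i \<omega>) (\<Pi>\<^sub>M i\<in>UNIV. borel) (\<lambda>\<omega> i. W \<rho> i t \<omega>)"
  unfolding indep_var_eq
proof (intro conjI)
  show "random_variable (\<Pi>\<^sub>M i\<in>UNIV. borel) (\<lambda>\<omega> i. Y \<rho> i \<omega>)"
    by (rule measurable_PiM_single')
       (auto intro: poisson_points_measurable[OF poisson[OF \<rho>]] simp: space_PiM)
  show "random_variable (\<Pi>\<^sub>M i\<in>UNIV. borel) (\<lambda>\<omega> i. W \<rho> i t \<omega>)"
    by (rule measurable_PiM_single')
       (auto intro: brownian_measurable[OF brownian[OF \<rho>] t] simp: space_PiM)
  define F where "F \<omega> = (\<lambda>(i, t)\<in>UNIV \<times> {0..}. W \<rho> i t \<omega>)" for \<omega>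
  define V where "V = vimage_algebra (space M) F (\<Pi>\<^sub>M p\<in>UNIV \<times> {0..}. borel)"
  have "F \<in> measurable V (\<Pi>\<^sub>M p\<in>UNIV \<times> {0..}. borel)"
    unfolding V_def by (rule measurable_vimage_algebra1) (auto simp: F_def space_PiM)
  moreover have "(\<lambda>f i. f (i, t)) \<in> measurable (\<Pi>\<^sub>M p\<in>UNIV \<times> {0..}. borel) (\<Pi>\<^sub>M i\<in>UNIV. borel :: (real ^ 'n) measure)"
    using t by (intro measurable_PiM_single') (auto simp: space_PiM intro!: measurable_component_singleton)
  ultimately have "(\<lambda>\<omega> i. F \<omega> (i, t)) \<in> measurable V (\<Pi>\<^sub>M i\<in>UNIV. borel)"
    by (rule measurable_compose)
  then have WV: "(\<lambda>\<omega> i. W \<rho> i t \<omega>) \<in> measurable V (\<Pi>\<^sub>M i\<in>UNIV. borel)"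
    using t by (simp add: F_def)
  have V: "space V = space M" by (simp add: V_def)
  have "{(\<lambda>\<omega> i. W \<rho> i t \<omega>) -` A \<inter> space V | A. A \<in> sets (\<Pi>\<^sub>M i\<in>UNIV. borel)} \<subseteq> sets V"
    using measurable_sets[OF WV] by blast
  from sets.sigma_sets_subset[OF this]
  have "sigma_sets (space M) {(\<lambda>\<omega> i. W \<rho> i t \<omega>) -` A \<inter> space M | A. A \<in> sets (\<Pi>\<^sub>M i\<in>UNIV. borel)} \<subseteq> sets V"
    unfolding V .
  moreover have "indep_set (sets (vimage_algebra (space M) (\<lambda>\<omega> i. Y \<rho> i \<omega>) (\<Pi>\<^sub>M i\<in>UNIV. borel))) (sets V)"
    unfolding V_def F_def by (rule indep_points_brownian[OF \<rho>])
  ultimately show "indep_set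
      (sigma_sets (space M) {(\<lambda>\<omega> i. Y \<rho> i \<omega>) -` A \<inter> space M | A. A \<in> sets (\<Pi>\<^sub>M i\<in>UNIV. borel)})
      (sigma_sets (space M) {(\<lambda>\<omega> i. W \<rho> i t \<omega>) -` A \<inter> space M | A. A \<in> sets (\<Pi>\<^sub>M i\<in>UNIV. borel)})"
    unfolding sets_vimage_algebra indep_sets2_eq by blast
qed

lemma indep_positions:
  assumes \<rho>: "0 < \<rho>" and t: "0 \<le> t"
  shows "indep_vars (\<lambda>_. borel) (\<lambda>i. W \<rho> i t) UNIV"
proof -
  have "indep_vars (\<lambda>_. borel) (\<lambda>i \<omega>. (\<lambda>t\<in>{0..}. W \<rho> i t \<omega>) t) UNIV"
    using t by (intro indep_vars_compose2[OF indep_brownian[OF \<rho>]] measurable_component_singleton) simp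
  then show ?thesis using t by simp
qed

text \<open>
  The points that start in \<open>D j\<close> and have displacement in \<open>C j\<close> form a thinning of the Poisson process
  with mean number \<open>\<rho> * measure lborel (D j) * p j\<close>, and the formula is the probability that all these
  thinnings are empty. Given the initial configuration, every point in \<open>D j\<close> independently avoids \<open>C j\<close>
  with probability \<open>1 - p j\<close>; averaging over the configuration is the generating function of the
  independent counts at \<open>1 - p j\<close>. The condition runs over all indices: which points belong to the
  unit cube is decided by the sets \<open>D j\<close>.
\<close>

lemma prob_no_transfer:
  fixes D C :: "nat \<Rightarrow> (real ^ 'n) set"
  assumes \<rho>: "0 < \<rho>" and t: "0 \<le> t"
    and D: "\<And>j. j < m \<Longrightarrow> D j \<in> sets borel \<and> bounded (D j)" "disjoint_family_on D {..<m}"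
    and C: "\<And>j. C j \<in> sets borel"
    and p: "\<And>i j. j < m \<Longrightarrow> prob {\<omega> \<in> space M. W \<rho> i t \<omega> \<in> C j} = p j"
  shows "{\<omega> \<in> space M. \<forall>i. \<forall>j<m. Y \<rho> i \<omega> \<in> D j \<longrightarrow> W \<rho> i t \<omega> \<notin> C j} \<in> events" (is "?A \<in> events")
    and "prob {\<omega> \<in> space M. \<forall>i. \<forall>j<m. Y \<rho> i \<omega> \<in> D j \<longrightarrow> W \<rho> i t \<omega> \<notin> C j} =
      exp (- \<rho> * (\<Sum>j<m. measure lborel (D j) * p j))"
proof -
  have [measurable]: "random_variable borel (Y \<rho> i)" "random_variable borel (W \<rho> i t)" for i
    by (rule poisson_points_measurable[OF poisson[OF \<rho>]] brownian_measurable[OF brownian[OF \<rho>] t])+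
  note [measurable] = C
  have p01: "0 \<le> p j \<and> p j \<le> 1" if "j < m" for j
    using p[OF that, of 0] by (metis measure_nonneg prob_le_1)
  have D_sets [measurable]: "j \<in> {..<m} \<Longrightarrow> D j \<in> sets borel" for j using D(1) by simp
  have "{\<omega> \<in> space M. \<forall>i. \<forall>j\<in>{..<m}. Y \<rho> i \<omega> \<in> D j \<longrightarrow> W \<rho> i t \<omega> \<notin> C j} \<in> events"
    by measurable
  then show ev: "?A \<in> events" by simp
  define E where "E = {x \<in> space ((\<Pi>\<^sub>M i\<in>UNIV. borel) \<Otimes>\<^sub>M (\<Pi>\<^sub>M i\<in>UNIV. borel)).
    \<forall>i::nat. \<forall>j\<in>{..<m}. fst x i \<in> D j \<longrightarrow> snd x i \<notin> C j}"
  have E: "E \<in> sets ((\<Pi>\<^sub>M i\<in>UNIV. borel) \<Otimes>\<^sub>M (\<Pi>\<^sub>M i\<in>UNIV. borel))"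
    unfolding E_def by measurable
  have in_E: "((\<lambda>i. y i), (\<lambda>i. z i)) \<in> E \<longleftrightarrow> (\<forall>i. \<forall>j<m. y i \<in> D j \<longrightarrow> z i \<notin> C j)" for y z
    by (auto simp: E_def space_pair_measure space_PiM)
  \<comment> \<open>For a frozen configuration only the finitely many indices with a point in some \<open>D j\<close> matter,
    and the sets \<open>D j\<close> being disjoint, each of them has exactly one forbidden set \<open>C j\<close>.\<close>
  have inner: "emeasure M {\<omega>' \<in> space M. \<forall>i. \<forall>j<m. Y \<rho> i \<omega> \<in> D j \<longrightarrow> W \<rho> i t \<omega>' \<notin> C j} =
      (\<Prod>j<m. ennreal ((1 - p j) ^ point_count (Y \<rho>) (D j) \<omega>))" if \<omega>: "\<omega> \<in> space M" for \<omega>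
  proof -
    define S where "S j = {i. Y \<rho> i \<omega> \<in> D j}" for j
    have S: "finite (S j)" if "j < m" for j
      using poisson_finite[OF poisson[OF \<rho>] \<omega>, of "D j"] D(1)[OF that] by (simp add: S_def)
    have S_disj: "S j \<inter> S k = {}" if "j < m" "k < m" "j \<noteq> k" for j k
      using D(2) that by (auto simp: S_def disjoint_family_on_def)
    define A where "A i = - (\<Union>j\<in>{j. j < m \<and> i \<in> S j}. C j)" for i
    have A_sets: "A i \<in> sets borel" for i
      unfolding A_def using C by (intro borel_comp sets.finite_UN) auto
    have A_eq: "A i = - C j" if "i \<in> S j" "j < m" for i j
    proof -
      have "{j. j < m \<and> i \<in> S j} = {j}" using that S_disj by blast
      then show ?thesis by (simp add: A_def)
    qed
    have "prob {\<omega>' \<in> space M. W \<rho> i t \<omega>' \<in> - C j} = 1 - p j" if "j < m" for i j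
    proof -
      have "{\<omega>' \<in> space M. W \<rho> i t \<omega>' \<in> C j} \<in> events" by measurable
      from prob_compl[OF this]
      have "prob (space M - {\<omega>' \<in> space M. W \<rho> i t \<omega>' \<in> C j}) = 1 - p j" by (simp only: p[OF that])
      moreover have "space M - {\<omega>' \<in> space M. W \<rho> i t \<omega>' \<in> C j} = {\<omega>' \<in> space M. W \<rho> i t \<omega>' \<in> - C j}"
        by blast
      ultimately show ?thesis by simp
    qed
    note compl = this
    have "{\<omega>' \<in> space M. \<forall>i. \<forall>j<m. Y \<rho> i \<omega> \<in> D j \<longrightarrow> W \<rho> i t \<omega>' \<notin> C j} =
        {\<omega>' \<in> space M. \<forall>i\<in>(\<Union>j<m. S j). W \<rho> i t \<omega>' \<in> A i}"
      by (auto simp: A_def S_def)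
    also have "prob \<dots> = (\<Prod>i\<in>(\<Union>j<m. S j). prob {\<omega>' \<in> space M. W \<rho> i t \<omega>' \<in> A i})"
      using S by (intro prob_indep_finite[OF indep_positions[OF \<rho> t]] A_sets) auto
    also have "\<dots> = (\<Prod>j<m. \<Prod>i\<in>S j. prob {\<omega>' \<in> space M. W \<rho> i t \<omega>' \<in> A i})"
      using S S_disj by (intro prod.UNION_disjoint) auto
    also have "\<dots> = (\<Prod>j<m. \<Prod>i\<in>S j. 1 - p j)"
      using A_eq compl by (intro prod.cong refl) simp
    also have "\<dots> = (\<Prod>j<m. (1 - p j) ^ point_count (Y \<rho>) (D j) \<omega>)"
      by (simp add: point_count_def S_def)
    finally show ?thesis
      using p01 by (subst prod_ennreal) (auto simp: emeasure_eq_measure)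
  qed
  have "indep_vars (\<lambda>_. borel) (\<lambda>j \<omega>. ennreal ((1 - p j) ^ point_count (Y \<rho>) (D j) \<omega>)) {..<m}"
    by (rule indep_vars_compose2[OF poisson_indep[OF poisson[OF \<rho>] D]]) auto
  note count_indep = this
  have "emeasure M ?A = (\<integral>\<^sup>+\<omega>. emeasure M {\<omega>' \<in> space M. \<forall>i. \<forall>j<m. Y \<rho> i \<omega> \<in> D j \<longrightarrow> W \<rho> i t \<omega>' \<notin> C j} \<partial>M)"
    using emeasure_indep_section[OF indep_points_positions[OF \<rho> t] E] unfolding in_E .
  also have "\<dots> = (\<integral>\<^sup>+\<omega>. (\<Prod>j<m. ennreal ((1 - p j) ^ point_count (Y \<rho>) (D j) \<omega>)) \<partial>M)"
    by (intro nn_integral_cong inner)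
  also have "\<dots> = (\<Prod>j<m. \<integral>\<^sup>+\<omega>. ennreal ((1 - p j) ^ point_count (Y \<rho>) (D j) \<omega>) \<partial>M)"
    by (intro indep_vars_nn_integral count_indep) auto
  also have "\<dots> = (\<Prod>j<m. ennreal (exp (\<rho> * measure lborel (D j) * (1 - p j - 1))))"
    using D(1) p01 \<rho> by (intro prod.cong refl poisson_generating_function[OF poisson[OF \<rho>]]) auto
  also have "\<dots> = ennreal (exp (- \<rho> * (\<Sum>j<m. measure lborel (D j) * p j)))"
    by (subst prod_ennreal) (auto simp: exp_sum[symmetric] sum_distrib_left sum_negf mult.assoc)
  finally show "prob ?A = exp (- \<rho> * (\<Sum>j<m. measure lborel (D j) * p j))"
    by (simp add: emeasure_eq_measure)
qed

end

section \<open>A grid of cells\<close>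

text \<open>
  The floor function makes the cells half-open, so they partition the whole space. The index \<open>k\<close> ranges over
  all integer vectors because differences of positions in the cube lie in cells outside it.
\<close>

definition cell :: "nat \<Rightarrow> ('n \<Rightarrow> int) \<Rightarrow> (real ^ 'n) set" where
  "cell K k = {x. \<forall>i. \<lfloor>real K * x $ i\<rfloor> = k i}"

text \<open>
  The indices of the cells that make up the unit cube, apart from the upper faces.
\<close>

definition grid :: "nat \<Rightarrow> ('n \<Rightarrow> int) set" where
  "grid K = (\<Pi>\<^sub>E i\<in>UNIV. {0..<int K})"

lemma grid_iff: "k \<in> grid K \<longleftrightarrow> (\<forall>i. 0 \<le> k i \<and> k i < int K)"
  by (auto simp: grid_def PiE_iff)

lemma finite_grid: "finite (grid K :: ('n::finite \<Rightarrow> int) set)"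
  by (simp add: grid_def finite_PiE)

lemma card_grid: "card (grid K :: ('n::finite \<Rightarrow> int) set) = K ^ CARD('n)"
  by (simp add: grid_def card_PiE)

lemma grid_enumeration:
  obtains h :: "nat \<Rightarrow> 'n::finite \<Rightarrow> int" where "bij_betw h {..<K ^ CARD('n)} (grid K)"
proof -
  have "finite (grid K :: ('n \<Rightarrow> int) set)" by (rule finite_grid)
  from ex_bij_betw_nat_finite[OF this] show ?thesis
    using that by (auto simp: card_grid atLeast0LessThan)
qed

lemma mem_cell:
  "x \<in> cell K k \<longleftrightarrow> (\<forall>i. of_int (k i) \<le> real K * x $ i \<and> real K * x $ i < of_int (k i) + 1)"
  by (simp add: cell_def floor_eq_iff)

lemma cell_disjoint: "k \<noteq> k' \<Longrightarrow> cell K k \<inter> cell K k' = {}"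
  by (auto simp: cell_def fun_eq_iff)

lemma cells_disjoint_family:
  "bij_betw h J G \<Longrightarrow> disjoint_family_on (\<lambda>j. cell K (h j)) J"
  using cell_disjoint unfolding disjoint_family_on_def bij_betw_def inj_on_def by metis

lemma cell_borel [measurable]: "cell K k \<in> sets borel"
  unfolding cell_def by measurable

lemma cell_bounds:
  fixes k :: "'n::finite \<Rightarrow> int"
  assumes "0 < K"
  defines "a \<equiv> \<chi> i. of_int (k i) / real K" and "b \<equiv> \<chi> i. (of_int (k i) + 1) / real K"
  shows "box a b \<subseteq> cell K k" "cell K k \<subseteq> cbox a b"
proof -
  have a: "a $ i < x \<longleftrightarrow> of_int (k i) < real K * x" "a $ i \<le> x \<longleftrightarrow> of_int (k i) \<le> real K * x" for i x
    using assms(1) by (simp_all add: a_def divide_less_eq divide_le_eq mult.commute)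
  have b: "x < b $ i \<longleftrightarrow> real K * x < of_int (k i) + 1" "x \<le> b $ i \<longleftrightarrow> real K * x \<le> of_int (k i) + 1" for i x
    using assms(1) by (simp_all add: b_def less_divide_eq le_divide_eq mult.commute)
  show "box a b \<subseteq> cell K k" "cell K k \<subseteq> cbox a b"
    unfolding subset_iff mem_box_cart mem_cell a b by (simp_all add: less_imp_le)
qed

lemma cell_bounded: "0 < K \<Longrightarrow> bounded (cell K k)"
  by (rule bounded_subset[OF bounded_cbox cell_bounds(2)])

lemma cell_subset_cube:
  assumes "0 < K" "k \<in> grid K"
  shows "cell K k \<subseteq> cbox 0 1"
proof
  fix x assume x: "x \<in> cell K k"
  have "0 \<le> x $ i \<and> x $ i \<le> 1" for i
  proof -
    have k: "0 \<le> k i" "k i < int K" using assms(2) by (simp_all add: grid_iff)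
    have "0 \<le> real K * x $ i" "real K * x $ i \<le> real K * 1"
      using x[unfolded mem_cell, rule_format, of i] k by linarith+
    then show ?thesis using assms(1) by (simp add: zero_le_mult_iff)
  qed
  then show "x \<in> cbox 0 1" by (simp add: mem_box_cart)
qed

lemma measure_cell:
  fixes k :: "'n::finite \<Rightarrow> int"
  assumes "0 < K"
  shows "measure lborel (cell K k) = (1 / real K) ^ CARD('n)"
proof -
  define a :: "real ^ 'n" where "a = (\<chi> i. of_int (k i) / real K)"
  define b :: "real ^ 'n" where "b = (\<chi> i. (of_int (k i) + 1) / real K)"
  have le: "a $ i \<le> b $ i" "b $ i - a $ i = 1 / real K" for i
    using assms by (auto simp: a_def b_def field_simps)
  have "measure lborel (cbox a b) = (\<Prod>i\<in>(UNIV::'n set). b $ i - a $ i)"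
    using le by (intro content_cbox_cart) (auto simp: interval_ne_empty_cart)
  then have cbox: "measure lborel (cbox a b) = (1 / real K) ^ CARD('n)"
    by (simp add: le)
  have "emeasure lborel (box a b) = emeasure lborel (cbox a b)"
    by (auto simp: emeasure_lborel_cbox_eq emeasure_lborel_box_eq)
  then have "measure lborel (box a b) = (1 / real K) ^ CARD('n)"
    using cbox by (simp add: measure_def)
  moreover have "measure lborel (box a b) \<le> measure lborel (cell K k)"
    using cell_bounds(1)[OF assms, of k] unfolding a_def b_def
    by (rule measure_mono_fmeasurable[OF _ _ fmeasurableI[OF _ emeasure_bounded_finite[OF cell_bounded[OF assms]]]]) auto
  moreover have "measure lborel (cell K k) \<le> measure lborel (cbox a b)"
    using cell_bounds(2)[OF assms, of k] unfolding a_def b_def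
    by (rule measure_mono_fmeasurable[OF _ _ fmeasurableI[OF _ emeasure_lborel_cbox_finite]]) auto
  ultimately show ?thesis using cbox by linarith
qed

text \<open>
  A point on an upper face of the cube is in no cell of the grid, but it is in the closure of one.
\<close>

lemma grid_point_near:
  fixes x :: "real ^ 'n"
  assumes K: "0 < K" and x: "x \<in> cbox 0 1"
  obtains k where "k \<in> grid K" "\<And>i. \<bar>real K * x $ i - of_int (k i)\<bar> \<le> 1"
proof
  define k where "k i = min \<lfloor>real K * x $ i\<rfloor> (int K - 1)" for i
  have x01: "0 \<le> x $ i" "x $ i \<le> 1" for i using x by (auto simp: mem_box_cart)
  then have "0 \<le> \<lfloor>real K * x $ i\<rfloor>" for i by simp
  then show "k \<in> grid K" using K by (auto simp: grid_iff k_def)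
  show "\<bar>real K * x $ i - of_int (k i)\<bar> \<le> 1" for i
  proof -
    have "real K * x $ i \<le> real K" using x01[of i] K by (simp add: mult_le_cancel_left1)
    then show ?thesis unfolding k_def by linarith
  qed
qed

text \<open>
  Adding the defining inequalities of the two cells puts \<open>y + w\<close> into a box of twice the side at
  \<open>k\<close>.
\<close>

lemma cell_transfer:
  fixes y w :: "real ^ 'n"
  assumes "y \<in> cell K j" "w \<in> cell K (\<lambda>i. k i - j i)"
  shows "\<bar>real K * (y + w) $ i - of_int (k i)\<bar> \<le> 2"
proof -
  have "real K * (y + w) $ i = real K * y $ i + real K * w $ i"
    by (simp add: distrib_left)
  then show ?thesis
    using assms(1)[unfolded mem_cell, rule_format, of i] assms(2)[unfolded mem_cell, rule_format, of i]
    unfolding of_int_diff by linarith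
qed

context prob_space
begin

text \<open>
  The displacement cells \<open>k - j\<close> belonging to a fixed target \<open>k\<close> tile a box of side one near the origin,
  so their probabilities add up to a quantity bounded below. This replaces integrating the density of the
  points at time \<open>t\<close> over the starting points.
\<close>

lemma brownian_cells:
  fixes W :: "real \<Rightarrow> 'a \<Rightarrow> real ^ 'n"
  assumes W: "standard_brownian_motion W" and t: "0 < t" "t \<le> 1" and K: "0 < K" and k: "k \<in> grid K"
  shows "box_const ^ CARD('n) \<le> (\<Sum>j\<in>grid K. prob {\<omega> \<in> space M. W t \<omega> \<in> cell K (\<lambda>i. k i - j i)})"
proof -
  define A where "A j = {\<omega> \<in> space M. W t \<omega> \<in> cell K (\<lambda>i. k i - j i)}" for j
  have [measurable]: "random_variable borel (W t)" using W t by (simp add: brownian_measurable)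
  have A: "A j \<in> events" for j unfolding A_def by measurable
  have disj: "disjoint_family_on A (grid K)"
  proof (unfold disjoint_family_on_def, intro ballI impI)
    fix j j' :: "'n \<Rightarrow> int" assume "j \<noteq> j'"
    then have "(\<lambda>i. k i - j i) \<noteq> (\<lambda>i. k i - j' i)" by (auto simp: fun_eq_iff)
    from cell_disjoint[OF this, of K] show "A j \<inter> A j' = {}" by (auto simp: A_def)
  qed
  \<comment> \<open>The cells \<open>k - j\<close>, for \<open>j\<close> in the grid, tile the half-open box \<open>[lo, hi)\<close> of side one. Either
    \<open>[0, 1 / 2)\<close> or \<open>[- 1 / 2, 0]\<close> is contained in each of its sides.\<close>
  define lo where "lo i = (of_int (k i) + 1 - real K) / real K" for i
  define hi where "hi i = (of_int (k i) + 1) / real K" for i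
  have lohi: "lo i \<le> 0 \<and> 1 / 2 \<le> hi i \<or> lo i \<le> - 1 / 2 \<and> 0 < hi i" for i
  proof -
    define z r where "z = real_of_int (k i) + 1" and "r = real K"
    have "0 \<le> k i" "k i < int K" using k by (simp_all add: grid_iff)
    then have z: "1 \<le> z" "z \<le> r" "0 < r" unfolding z_def r_def by linarith+
    show ?thesis
    proof (cases "r \<le> 2 * z")
      case True
      then have "(z - r) / r \<le> 0" "1 / 2 \<le> z / r"
        using z by (simp_all add: le_divide_eq divide_le_eq)
      then show ?thesis unfolding lo_def hi_def z_def r_def by blast
    next
      case False
      then have "(z - r) / r \<le> - 1 / 2" "0 < z / r"
        using z by (simp_all add: divide_le_eq)
      then show ?thesis unfolding lo_def hi_def z_def r_def by blast
    qed
  qed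
  have "box_const ^ CARD('n) \<le> prob {\<omega> \<in> space M. \<forall>i. lo i \<le> W t \<omega> $ i \<and> W t \<omega> $ i < hi i}"
    using brownian_box[OF W t lohi] .
  also have "\<dots> \<le> prob (\<Union>j\<in>grid K. A j)"
  proof (rule finite_measure_mono)
    show "{\<omega> \<in> space M. \<forall>i. lo i \<le> W t \<omega> $ i \<and> W t \<omega> $ i < hi i} \<subseteq> (\<Union>j\<in>grid K. A j)"
    proof
      fix \<omega> assume "\<omega> \<in> {\<omega> \<in> space M. \<forall>i. lo i \<le> W t \<omega> $ i \<and> W t \<omega> $ i < hi i}"
      then have \<omega>: "\<omega> \<in> space M" "\<And>i. lo i \<le> W t \<omega> $ i" "\<And>i. W t \<omega> $ i < hi i" by auto
      define j where "j i = k i - \<lfloor>real K * W t \<omega> $ i\<rfloor>" for i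
      have "0 \<le> j i \<and> j i < int K" for i
      proof -
        have "of_int (k i) + 1 - real K \<le> real K * W t \<omega> $ i" "real K * W t \<omega> $ i < of_int (k i) + 1"
          using \<omega>(2,3)[of i] K by (simp_all add: lo_def hi_def divide_le_eq less_divide_eq mult.commute)
        then show ?thesis unfolding j_def by linarith
      qed
      then have "j \<in> grid K" by (simp add: grid_iff)
      moreover have "\<omega> \<in> A j" using \<omega>(1) by (simp add: A_def cell_def j_def)
      ultimately show "\<omega> \<in> (\<Union>j\<in>grid K. A j)" by blast
    qed
    show "(\<Union>j\<in>grid K. A j) \<in> events" using A finite_grid by (intro sets.finite_UN) auto
  qed
  also have "\<dots> = (\<Sum>j\<in>grid K. prob (A j))"
    using A disj finite_grid by (intro finite_measure_finite_Union) auto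
  finally show ?thesis by (simp add: A_def)
qed

end

section \<open>Bounds at a fixed intensity\<close>

context generalized_cylinder_model
begin

text \<open>
  At time \<open>0\<close> the midpoint of an empty cell is not covered by discs of radius less than half its
  side.
\<close>

lemma empty_cell_radius:
  assumes \<rho>: "0 < \<rho>" and \<omega>: "\<omega> \<in> space M" and K: "0 < K" and k: "k \<in> grid K"
    and empty: "point_count (Y \<rho>) (cell K k) \<omega> = 0"
  shows "ereal (1 / (2 * real K)) \<le> radius \<rho> \<omega>"
proof (rule radius_ge)
  fix r assume r: "0 \<le> r" "covered \<rho> r \<omega>"
  define x :: "real ^ 'n" where "x = (\<chi> i. (of_int (k i) + 1 / 2) / real K)"
  have Kx: "real K * x $ i = of_int (k i) + 1 / 2" for i
    using K by (simp add: x_def)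
  have "x \<in> cell K k"
    unfolding mem_cell Kx by simp
  then have "x \<in> cbox 0 1"
    using cell_subset_cube[OF K k] by blast
  then obtain i where "dist x (Y \<rho> i \<omega> + W \<rho> i 0 \<omega>) \<le> r"
    using r(2) unfolding covered_def by fastforce
  then have i: "norm (x - Y \<rho> i \<omega>) \<le> r"
    using brownian_start[OF brownian[OF \<rho>] \<omega>] by (simp add: dist_norm)
  have "finite {i. Y \<rho> i \<omega> \<in> cell K k}"
    by (rule poisson_finite[OF poisson[OF \<rho>] \<omega> cell_bounded[OF K]])
  then have "Y \<rho> i \<omega> \<notin> cell K k"
    using empty by (auto simp: point_count_def)
  then obtain l where "\<not> (of_int (k l) \<le> real K * Y \<rho> i \<omega> $ l \<and> real K * Y \<rho> i \<omega> $ l < of_int (k l) + 1)"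
    unfolding mem_cell by blast
  then have "1 / 2 \<le> \<bar>real K * x $ l - real K * Y \<rho> i \<omega> $ l\<bar>"
    unfolding Kx by linarith
  also have "\<dots> = real K * \<bar>(x - Y \<rho> i \<omega>) $ l\<bar>"
    by (simp add: abs_mult flip: right_diff_distrib)
  also have "\<dots> \<le> real K * r"
    using component_le_norm_cart[of "x - Y \<rho> i \<omega>" l] i by (intro mult_left_mono) auto
  finally show "1 / (2 * real K) \<le> r"
    using K by (simp add: divide_le_eq mult.commute)
qed

text \<open>
  A small radius forces every cell to be occupied at time \<open>0\<close>, and the occupations are
  independent.
\<close>

lemma prob_radius_small:
  assumes \<rho>: "0 < \<rho>" and K: "0 < K"
  shows "prob {\<omega> \<in> space M. radius \<rho> \<omega> < ereal (1 / (2 * real K))}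
    \<le> (1 - exp (- (\<rho> / real K ^ CARD('n)))) ^ (K ^ CARD('n))"
proof -
  define m where "m = K ^ CARD('n)"
  have m: "0 < m" using K by (simp add: m_def)
  obtain h :: "nat \<Rightarrow> 'n \<Rightarrow> int" where h: "bij_betw h {..<m} (grid K)"
    unfolding m_def by (rule grid_enumeration)
  define Z where "Z j = point_count (Y \<rho>) (cell K (h j))" for j
  have indep: "indep_vars (\<lambda>_. count_space UNIV) Z {..<m}"
    unfolding Z_def using cell_bounded[OF K]
    by (intro poisson_indep[OF poisson[OF \<rho>]] cells_disjoint_family[OF h]) auto
  then have [measurable]: "j < m \<Longrightarrow> random_variable (count_space UNIV) (Z j)" for j
    by (simp add: indep_vars_def)
  have occupied: "prob (Z j -` {0<..} \<inter> space M) = 1 - exp (- (\<rho> / real K ^ CARD('n)))" if j: "j < m" for j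
  proof -
    have "{\<omega> \<in> space M. Z j \<omega> = 0} \<in> events" using j by measurable
    from prob_compl[OF this]
    have "prob (space M - {\<omega> \<in> space M. Z j \<omega> = 0}) = 1 - exp (- (\<rho> / real K ^ CARD('n)))"
      using poisson_mass[OF poisson[OF \<rho>] cell_borel cell_bounded[OF K], of "h j" 0]
      by (simp add: Z_def measure_cell[OF K] power_divide)
    moreover have "space M - {\<omega> \<in> space M. Z j \<omega> = 0} = Z j -` {0<..} \<inter> space M" by auto
    ultimately show ?thesis by simp
  qed
  have "prob {\<omega> \<in> space M. radius \<rho> \<omega> < ereal (1 / (2 * real K))} \<le> prob (\<Inter>j\<in>{..<m}. Z j -` {0<..} \<inter> space M)"
  proof (rule finite_measure_mono)
    show "{\<omega> \<in> space M. radius \<rho> \<omega> < ereal (1 / (2 * real K))} \<subseteq> (\<Inter>j\<in>{..<m}. Z j -` {0<..} \<inter> space M)"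
    proof (safe)
      fix \<omega> j assume \<omega>: "\<omega> \<in> space M" "radius \<rho> \<omega> < ereal (1 / (2 * real K))" and j: "j < m"
      have "h j \<in> grid K" using h j by (auto simp: bij_betw_def)
      from empty_cell_radius[OF \<rho> \<omega>(1) K this] \<omega>(2) have "Z j \<omega> \<noteq> 0"
        unfolding Z_def by (metis not_le)
      then show "\<omega> \<in> Z j -` {0<..}" by simp
    qed
    show "(\<Inter>j\<in>{..<m}. Z j -` {0<..} \<inter> space M) \<in> events"
      using m by (intro sets.finite_INT) (auto intro: measurable_sets)
  qed
  also have "\<dots> = (\<Prod>j<m. prob (Z j -` {0<..} \<inter> space M))"
    using m by (intro indep_varsD[OF indep]) auto
  also have "\<dots> = (1 - exp (- (\<rho> / real K ^ CARD('n)))) ^ m"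
    using occupied by simp
  finally show ?thesis by (simp add: m_def)
qed

text \<open>
  A point that starts in cell \<open>j\<close> and has its displacement in cell \<open>k - j\<close> ends within two sides of the
  target \<open>k\<close>. The expected number of such points, over all \<open>j\<close>, is \<open>\<rho>\<close> times the volume of a cell times
  the sum of the probabilities of the displacement cells.
\<close>

lemma grid_point_hit:
  assumes \<rho>: "0 < \<rho>" and t: "0 < t" "t \<le> 1" and K: "0 < K" and k: "k \<in> grid K"
  obtains B where "B \<in> events" "prob B \<le> exp (- \<rho> * (box_const / real K) ^ CARD('n))"
    "\<And>\<omega>. \<omega> \<in> space M - B \<Longrightarrow>
      \<exists>i<num_points \<rho> \<omega>. \<forall>l. \<bar>real K * (Y \<rho> i \<omega> + W \<rho> i t \<omega>) $ l - of_int (k l)\<bar> \<le> 2"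
proof -
  define m where "m = K ^ CARD('n)"
  obtain h :: "nat \<Rightarrow> 'n \<Rightarrow> int" where h: "bij_betw h {..<m} (grid K)"
    unfolding m_def by (rule grid_enumeration)
  define C where "C j = cell K (\<lambda>l. k l - h j l)" for j
  \<comment> \<open>The law of the displacement is the same for all points, so index \<open>0\<close> can stand for all.\<close>
  define p where "p j = prob {\<omega> \<in> space M. W \<rho> 0 t \<omega> \<in> C j}" for j
  define B where "B = {\<omega> \<in> space M. \<forall>i. \<forall>j<m. Y \<rho> i \<omega> \<in> cell K (h j) \<longrightarrow> W \<rho> i t \<omega> \<notin> C j}"
  have C: "C j \<in> sets borel" for j unfolding C_def by (rule cell_borel)
  have law: "prob {\<omega> \<in> space M. W \<rho> i t \<omega> \<in> C j} = p j" for i j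
    unfolding p_def by (rule brownian_law[OF brownian[OF \<rho>] brownian[OF \<rho>] t(1) C])
  have D: "j < m \<Longrightarrow> cell K (h j) \<in> sets borel \<and> bounded (cell K (h j))" for j
    using cell_bounded[OF K] cell_borel by blast
  note no_transfer = prob_no_transfer[OF \<rho> less_imp_le[OF t(1)] D cells_disjoint_family[OF h] C law]
  have B: "B \<in> events"
    unfolding B_def by (rule no_transfer(1))
  have "(\<Sum>j<m. p j) = (\<Sum>j\<in>grid K. prob {\<omega> \<in> space M. W \<rho> 0 t \<omega> \<in> cell K (\<lambda>i. k i - j i)})"
    unfolding p_def C_def by (rule sum.reindex_bij_betw[OF h])
  then have "box_const ^ CARD('n) \<le> (\<Sum>j<m. p j)"
    using brownian_cells[OF brownian[OF \<rho>] t K k] by simp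
  then have "(box_const / real K) ^ CARD('n) \<le> (\<Sum>j<m. measure lborel (cell K (h j)) * p j)"
    by (simp add: measure_cell[OF K] power_divide divide_right_mono flip: sum_divide_distrib)
  then have "exp (- \<rho> * (\<Sum>j<m. measure lborel (cell K (h j)) * p j)) \<le> exp (- \<rho> * (box_const / real K) ^ CARD('n))"
    using \<rho> by simp
  moreover have "prob B = exp (- \<rho> * (\<Sum>j<m. measure lborel (cell K (h j)) * p j))"
    unfolding B_def by (rule no_transfer(2))
  ultimately have prob_B: "prob B \<le> exp (- \<rho> * (box_const / real K) ^ CARD('n))"
    by (simp only:)
  have "\<exists>i<num_points \<rho> \<omega>. \<forall>l. \<bar>real K * (Y \<rho> i \<omega> + W \<rho> i t \<omega>) $ l - of_int (k l)\<bar> \<le> 2"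
    if \<omega>: "\<omega> \<in> space M - B" for \<omega>
  proof -
    from \<omega> obtain i j where j: "j < m" and ij: "Y \<rho> i \<omega> \<in> cell K (h j)" "W \<rho> i t \<omega> \<in> C j"
      unfolding B_def by blast
    have "h j \<in> grid K" using h j by (auto simp: bij_betw_def)
    then have "Y \<rho> i \<omega> \<in> cbox 0 1" using ij(1) cell_subset_cube[OF K] by blast
    then have "i < num_points \<rho> \<omega>" using indexing[OF \<rho>] \<omega> by blast
    moreover have "\<bar>real K * (Y \<rho> i \<omega> + W \<rho> i t \<omega>) $ l - of_int (k l)\<bar> \<le> 2" for l
      using ij unfolding C_def by (rule cell_transfer)
    ultimately show "\<exists>i<num_points \<rho> \<omega>. \<forall>l. \<bar>real K * (Y \<rho> i \<omega> + W \<rho> i t \<omega>) $ l - of_int (k l)\<bar> \<le> 2"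
      by blast
  qed
  with B prob_B show ?thesis by (rule that)
qed

text \<open>
  The three summands bound the probabilities that there are \<open>m\<close> or more points in the cube, that one of the
  first \<open>m\<close> motions oscillates too much during one of \<open>L\<close> time intervals, and that some grid target is
  missed at some grid time. Capping the number of points allows a plain union bound over the indices
  \<open>i < m\<close>, without reference to the dependence between the enumeration and the motions. If none of this
  happens, a point \<open>x\<close> at time \<open>t\<close> is reached in three moves: from \<open>x\<close> to its
  grid target, from there to a point near the target at the next grid time, and along its motion back to
  time \<open>t\<close>.
\<close>

lemma coverage_failure:
  fixes m L K :: nat
  assumes \<rho>: "0 < \<rho>" and K: "0 < K" and L: "0 < L" and a: "0 < a"
  obtains B where "B \<in> events"
    "prob B \<le> exp \<rho> / 2 ^ m + real m * real L * (160 * sqrt 2 ^ CARD('n) * ((1 / real L)\<^sup>2 / a ^ 4))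
      + real K ^ CARD('n) * real L * exp (- \<rho> * (box_const / real K) ^ CARD('n))"
    "\<And>\<omega>. \<omega> \<in> space M - B \<Longrightarrow> covered \<rho> (3 * real CARD('n) / real K + 20 * a) \<omega>"
proof -
  define osc where "osc i q B \<longleftrightarrow> B \<in> events \<and> prob B \<le> 160 * sqrt 2 ^ CARD('n) * ((1 / real L)\<^sup>2 / a ^ 4) \<and>
      (\<forall>\<omega>\<in>space M - B. \<forall>s\<in>{real q / real L..real q / real L + 1 / real L}.
        norm (W \<rho> i s \<omega> - W \<rho> i (real q / real L) \<omega>) \<le> 10 * a)" for i q B
  define B1 where "B1 i q = (SOME B. osc i q B)" for i q
  have "osc i q (B1 i q)" for i q
    unfolding B1_def
  proof (rule someI_ex)
    have "0 \<le> real q / real L" "0 < 1 / real L" using L by simp_all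
    from brownian_oscillation[OF brownian[OF \<rho>] this a, of i] show "\<exists>B. osc i q B"
      unfolding osc_def by (metis (no_types, lifting))
  qed
  note B1 = this[unfolded osc_def]
  define hit where "hit k q B \<longleftrightarrow> B \<in> events \<and> prob B \<le> exp (- \<rho> * (box_const / real K) ^ CARD('n)) \<and>
      (\<forall>\<omega>\<in>space M - B. \<exists>i<num_points \<rho> \<omega>. \<forall>l.
        \<bar>real K * (Y \<rho> i \<omega> + W \<rho> i (real (Suc q) / real L) \<omega>) $ l - of_int (k l)\<bar> \<le> 2)" for k q B
  define B2 where "B2 k q = (SOME B. hit k q B)" for k q
  have "hit k q (B2 k q)" if "k \<in> grid K" "q < L" for k q
    unfolding B2_def
  proof (rule someI_ex)
    have "0 < real (Suc q) / real L" "real (Suc q) / real L \<le> 1" using that(2) by auto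
    from grid_point_hit[OF \<rho> this K that(1)] show "\<exists>B. hit k q B"
      unfolding hit_def by (metis (no_types, lifting))
  qed
  note B2 = this[unfolded hit_def]
  define A0 where "A0 = {\<omega> \<in> space M. m \<le> num_points \<rho> \<omega>}"
  define A1 where "A1 = (\<Union>(i, q)\<in>{..<m} \<times> {..<L}. B1 i q)"
  define A2 where "A2 = (\<Union>(k, q)\<in>grid K \<times> {..<L}. B2 k q)"
  have [measurable]: "random_variable (count_space UNIV) (num_points \<rho>)"
    by (rule point_count_measurable[OF poisson[OF \<rho>]]) simp_all
  have A0: "A0 \<in> events" unfolding A0_def by measurable
  have A1: "A1 \<in> events" unfolding A1_def using B1 by (intro sets.finite_UN) auto
  have A2: "A2 \<in> events" unfolding A2_def using B2 by (intro sets.finite_UN finite_cartesian_product finite_grid) auto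
  have "measure lborel (cbox 0 (1 :: real ^ 'n)) = 1"
    by (subst content_cbox_cart) (auto simp: interval_ne_empty_cart)
  then have prob_A0: "prob A0 \<le> exp \<rho> / 2 ^ m"
    unfolding A0_def using poisson_tail[OF poisson[OF \<rho>], of "cbox 0 1" m] \<rho> by simp
  have "prob A1 \<le> (\<Sum>(i, q)\<in>{..<m} \<times> {..<L}. prob (B1 i q))"
    unfolding A1_def using B1
    by (intro order_trans[OF finite_measure_subadditive_finite]) (auto simp: case_prod_unfold)
  also have "\<dots> \<le> (\<Sum>(i, q)\<in>{..<m} \<times> {..<L}. 160 * sqrt 2 ^ CARD('n) * ((1 / real L)\<^sup>2 / a ^ 4))"
    using B1 by (intro sum_mono) auto
  also have "\<dots> = real m * real L * (160 * sqrt 2 ^ CARD('n) * ((1 / real L)\<^sup>2 / a ^ 4))"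
    by (simp add: case_prod_unfold)
  finally have prob_A1: "prob A1 \<le> \<dots>" .
  have "prob A2 \<le> (\<Sum>(k, q)\<in>grid K \<times> {..<L}. prob (B2 k q))"
    unfolding A2_def using B2
    by (intro order_trans[OF finite_measure_subadditive_finite] finite_cartesian_product finite_grid)
       (auto simp: case_prod_unfold)
  also have "\<dots> \<le> (\<Sum>(k, q)\<in>(grid K :: ('n \<Rightarrow> int) set) \<times> {..<L}. exp (- \<rho> * (box_const / real K) ^ CARD('n)))"
    using B2 by (intro sum_mono) auto
  also have "\<dots> = real K ^ CARD('n) * real L * exp (- \<rho> * (box_const / real K) ^ CARD('n))"
    by (simp add: case_prod_unfold card_cartesian_product card_grid)
  finally have prob_A2: "prob A2 \<le> \<dots>" .
  show ?thesis
  proof (rule that[of "A0 \<union> (A1 \<union> A2)"])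
    show "A0 \<union> (A1 \<union> A2) \<in> events" using A0 A1 A2 by simp
    have "prob (A0 \<union> (A1 \<union> A2)) \<le> prob A0 + (prob A1 + prob A2)"
      using measure_Un_le[OF A0 sets.Un[OF A1 A2]] measure_Un_le[OF A1 A2] by linarith
    then show "prob (A0 \<union> (A1 \<union> A2)) \<le> exp \<rho> / 2 ^ m
        + real m * real L * (160 * sqrt 2 ^ CARD('n) * ((1 / real L)\<^sup>2 / a ^ 4))
        + real K ^ CARD('n) * real L * exp (- \<rho> * (box_const / real K) ^ CARD('n))"
      using prob_A0 prob_A1 prob_A2 by linarith
  next
    fix \<omega> assume \<omega>: "\<omega> \<in> space M - (A0 \<union> (A1 \<union> A2))"
    show "covered \<rho> (3 * real CARD('n) / real K + 20 * a) \<omega>"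
      unfolding covered_def
    proof (intro ballI)
      fix x :: "real ^ 'n" and t :: real assume x: "x \<in> cbox 0 1" and t: "t \<in> {0..1}"
      obtain k where k: "k \<in> grid K" "\<And>l. \<bar>real K * x $ l - of_int (k l)\<bar> \<le> 1"
        using grid_point_near[OF K x] by blast
      obtain q where q: "q < L" "real q / real L \<le> t" "t \<le> real q / real L + 1 / real L"
      proof
        define q where "q = min (nat \<lfloor>real L * t\<rfloor>) (L - 1)"
        show "q < L" using L by (simp add: q_def)
        have Lt: "0 \<le> real L * t" "real L * t \<le> real L" using t L by (auto simp: mult_le_cancel_left1)
        then have "real q \<le> real L * t" unfolding q_def by linarith
        then show "real q / real L \<le> t" using L by (simp add: divide_le_eq mult.commute)
        have "real L * t \<le> real q + 1" using Lt L unfolding q_def by linarith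
        then show "t \<le> real q / real L + 1 / real L"
          using L by (simp add: le_divide_eq mult.commute flip: add_divide_distrib)
      qed
      define u where "u = real q / real L"
      define s where "s = real (Suc q) / real L"
      have s: "s = u + 1 / real L" by (simp add: s_def u_def add_divide_distrib)
      \<comment> \<open>The grid time after \<open>t\<close> is used: at time \<open>0\<close> the displacement has no density.\<close>
      have "\<omega> \<in> space M - B2 k q" using \<omega> k(1) q(1) unfolding A2_def by blast
      then obtain i where i: "i < num_points \<rho> \<omega>"
          "\<And>l. \<bar>real K * (Y \<rho> i \<omega> + W \<rho> i s \<omega>) $ l - of_int (k l)\<bar> \<le> 2"
        using B2[OF k(1) q(1)] unfolding s_def by blast
      have "i < m" using i(1) \<omega> unfolding A0_def by auto
      then have "\<omega> \<in> space M - B1 i q" using \<omega> q(1) unfolding A1_def by blast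
      then have osc: "norm (W \<rho> i t \<omega> - W \<rho> i u \<omega>) \<le> 10 * a" "norm (W \<rho> i s \<omega> - W \<rho> i u \<omega>) \<le> 10 * a"
        using B1[of i q] q(2,3) s L unfolding u_def by auto
      have "norm (x - (Y \<rho> i \<omega> + W \<rho> i s \<omega>)) \<le> (\<Sum>l\<in>UNIV. \<bar>(x - (Y \<rho> i \<omega> + W \<rho> i s \<omega>)) $ l\<bar>)"
        by (rule norm_le_l1_cart)
      also have "\<dots> \<le> (\<Sum>l\<in>(UNIV :: 'n set). 3 / real K)"
      proof (rule sum_mono)
        fix l
        have "real K * \<bar>(x - (Y \<rho> i \<omega> + W \<rho> i s \<omega>)) $ l\<bar> =
            \<bar>real K * x $ l - real K * (Y \<rho> i \<omega> + W \<rho> i s \<omega>) $ l\<bar>"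
          by (simp only: vector_minus_component right_diff_distrib[symmetric] abs_mult abs_of_nat)
        also have "\<dots> \<le> 3" using k(2)[of l] i(2)[of l] by linarith
        finally show "\<bar>(x - (Y \<rho> i \<omega> + W \<rho> i s \<omega>)) $ l\<bar> \<le> 3 / real K"
          using K by (simp add: le_divide_eq mult.commute)
      qed
      finally have "norm (x - (Y \<rho> i \<omega> + W \<rho> i s \<omega>)) \<le> 3 * real CARD('n) / real K" by (simp add: mult.commute)
      moreover have "norm (x - (Y \<rho> i \<omega> + W \<rho> i t \<omega>)) \<le> norm (x - (Y \<rho> i \<omega> + W \<rho> i s \<omega>))
          + (norm (W \<rho> i s \<omega> - W \<rho> i u \<omega>) + norm (W \<rho> i t \<omega> - W \<rho> i u \<omega>))"
        by norm
      ultimately have "norm (x - (Y \<rho> i \<omega> + W \<rho> i t \<omega>)) \<le> 3 * real CARD('n) / real K + 20 * a"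
        using osc by linarith
      then show "\<exists>i<num_points \<rho> \<omega>. dist x (Y \<rho> i \<omega> + W \<rho> i t \<omega>) \<le> 3 * real CARD('n) / real K + 20 * a"
        using i(1) by (auto simp: dist_norm)
    qed
  qed
qed

end

section \<open>The logarithmic scale\<close>

definition coverage_scale :: "nat \<Rightarrow> real \<Rightarrow> real" where
  "coverage_scale n \<rho> = (ln \<rho> / \<rho>) powr (1 / real n)"

lemma ln_ge_1:
  fixes \<rho> :: real
  assumes "3 \<le> \<rho>"
  shows "1 \<le> ln \<rho>"
  using assms exp_le by (subst ln_ge_iff) linarith+

lemma coverage_scale_pos: "3 \<le> \<rho> \<Longrightarrow> 0 < coverage_scale n \<rho>"
  using ln_ge_1[of \<rho>] by (simp add: coverage_scale_def)

lemma coverage_scale_power: "3 \<le> \<rho> \<Longrightarrow> 0 < n \<Longrightarrow> coverage_scale n \<rho> ^ n = ln \<rho> / \<rho>"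
  using ln_ge_1[of \<rho>] unfolding coverage_scale_def
  by (simp add: powr_realpow[symmetric] powr_powr)

lemma coverage_scale_le_1:
  assumes "3 \<le> \<rho>" "0 < n"
  shows "coverage_scale n \<rho> \<le> 1"
proof (rule ccontr)
  assume "\<not> coverage_scale n \<rho> \<le> 1"
  then have "1 < coverage_scale n \<rho> ^ n" using assms(2) by (intro one_less_power) auto
  moreover have "ln \<rho> / \<rho> \<le> 1" using ln_le_minus_one[of \<rho>] assms(1) by simp
  ultimately show False unfolding coverage_scale_power[OF assms] by simp
qed

lemma coverage_scale_ge:
  assumes "3 \<le> \<rho>" "0 < n"
  shows "1 / \<rho> \<le> coverage_scale n \<rho>"
proof -
  have "1 / \<rho> \<le> ln \<rho> / \<rho>" using ln_ge_1[OF assms(1)] assms(1) by (simp add: divide_right_mono)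
  also have "\<dots> = coverage_scale n \<rho> ^ n" by (rule coverage_scale_power[OF assms, symmetric])
  also have "\<dots> \<le> coverage_scale n \<rho> ^ 1"
    using coverage_scale_pos[OF assms(1), of n] coverage_scale_le_1[OF assms] assms(2)
    by (intro power_decreasing) (auto simp: Suc_leI)
  finally show ?thesis by simp
qed

context generalized_cylinder_model
begin

context
  fixes \<rho> :: real
  assumes large: "3 \<le> \<rho>"
begin

text \<open>
  The exponent is, up to the sign, twice \<open>sqrt \<rho> / ln \<rho>\<close>, so the bound vanishes as \<open>\<rho>\<close>
  grows.
\<close>

lemma prob_radius_below_scale:
  "prob {\<omega> \<in> space M. radius \<rho> \<omega> < ereal (1 / 6 * coverage_scale CARD('n) \<rho>)} \<le> exp (- (exp (- (ln \<rho> / 2)) * (2 * \<rho> / ln \<rho>)))"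
proof -
  note scale = coverage_scale_pos[OF large, of "CARD('n)"] coverage_scale_le_1[OF large, of "CARD('n)"]
    and scale_power = coverage_scale_power[OF large, of "CARD('n)"] and ln_ge_1 = ln_ge_1[OF large]
  \<comment> \<open>Then \<open>K ^ CARD('n)\<close> is at least \<open>2 * \<rho> / ln \<rho>\<close>, hence a cell is empty with probability at least
    \<open>1 / sqrt \<rho>\<close>. Rounding up costs at most a factor \<open>3 / 2\<close>.\<close>
  define K where "K = nat \<lceil>2 / coverage_scale CARD('n) \<rho>\<rceil>"
  have "0 < 2 / coverage_scale CARD('n) \<rho>" using scale by simp
  then have K: "2 / coverage_scale CARD('n) \<rho> \<le> real K" "real K \<le> 2 / coverage_scale CARD('n) \<rho> + 1"
    unfolding K_def by linarith+
  have K0: "0 < K" using K(1) \<open>0 < 2 / coverage_scale CARD('n) \<rho>\<close> by (metis of_nat_0 less_le_not_le gr0I)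
  have "real K \<le> 3 / coverage_scale CARD('n) \<rho>"
  proof -
    have "1 \<le> 1 / coverage_scale CARD('n) \<rho>" using scale by (simp add: le_divide_eq)
    moreover have "3 / coverage_scale CARD('n) \<rho> = 2 / coverage_scale CARD('n) \<rho> + 1 / coverage_scale CARD('n) \<rho>" by (simp flip: add_divide_distrib)
    ultimately show ?thesis using K(2) by linarith
  qed
  then have "1 / 6 * coverage_scale CARD('n) \<rho> \<le> 1 / (2 * real K)"
    using K0 scale by (simp add: field_simps)
  then have "prob {\<omega> \<in> space M. radius \<rho> \<omega> < ereal (1 / 6 * coverage_scale CARD('n) \<rho>)}
      \<le> prob {\<omega> \<in> space M. radius \<rho> \<omega> < ereal (1 / (2 * real K))}"
    using radius_measurable[of \<rho>] large
    by (intro finite_measure_mono) (auto intro: less_le_trans borel_measurable_less)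
  also have "\<dots> \<le> (1 - exp (- (\<rho> / real K ^ CARD('n)))) ^ (K ^ CARD('n))"
    using large by (intro prob_radius_small K0) simp
  also have "\<dots> \<le> exp (- exp (- (\<rho> / real K ^ CARD('n)))) ^ (K ^ CARD('n))"
    using exp_ge_add_one_self[of "- exp (- (\<rho> / real K ^ CARD('n)))"] large
    by (intro power_mono) auto
  also have "\<dots> = exp (- (exp (- (\<rho> / real K ^ CARD('n))) * real K ^ CARD('n)))"
    by (simp add: exp_of_nat_mult[symmetric] mult.commute)
  also have "\<dots> \<le> exp (- (exp (- (ln \<rho> / 2)) * (2 * \<rho> / ln \<rho>)))"
  proof -
    have "2 * \<rho> / ln \<rho> \<le> 2 ^ CARD('n) * (\<rho> / ln \<rho>)"
      using self_le_power[of "2::real" "CARD('n)"] ln_ge_1 large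
      by (auto simp: times_divide_eq_right[symmetric] simp del: times_divide_eq_right intro!: mult_right_mono)
    also have "\<dots> = (2 / coverage_scale CARD('n) \<rho>) ^ CARD('n)"
      by (simp add: power_divide scale_power)
    also have "\<dots> \<le> real K ^ CARD('n)"
      using K(1) scale by (intro power_mono) (auto simp: less_imp_le)
    finally have KN: "2 * \<rho> / ln \<rho> \<le> real K ^ CARD('n)" .
    have "\<rho> / real K ^ CARD('n) \<le> \<rho> / (2 * \<rho> / ln \<rho>)"
      using KN ln_ge_1 large K0 by (intro divide_left_mono) (auto intro!: mult_pos_pos divide_pos_pos)
    also have "\<dots> = ln \<rho> / 2" using large by simp
    finally have "exp (- (ln \<rho> / 2)) \<le> exp (- (\<rho> / real K ^ CARD('n)))" by simp
    then have "exp (- (ln \<rho> / 2)) * (2 * \<rho> / ln \<rho>) \<le> exp (- (\<rho> / real K ^ CARD('n))) * real K ^ CARD('n)"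
      using KN ln_ge_1 large by (intro mult_mono) auto
    then show ?thesis by simp
  qed
  finally show ?thesis .
qed

text \<open>
  The assumption on \<open>ln \<rho> / \<rho>\<close> makes the cells so small that rounding their number up changes it by at
  most a factor \<open>2\<close>. The constant \<open>C\<close> is chosen such that the probability of missing a target is
  smaller than the inverse of the number of targets and grid times.
\<close>

lemma covered_at_scale:
  defines "C \<equiv> 108 * real CARD('n) / box_const"
  assumes dense: "ln \<rho> / \<rho> \<le> (box_const / 18) ^ CARD('n)"
  obtains B where "B \<in> events"
    "prob B \<le> exp (- \<rho>) + 800 * sqrt 2 ^ CARD('n) * (40 / C) ^ 4 / \<rho> + 2 / \<rho>\<^sup>2"
    "\<And>\<omega>. \<omega> \<in> space M - B \<Longrightarrow> covered \<rho> (C * coverage_scale CARD('n) \<rho>) \<omega>"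
proof -
  define \<phi> where "\<phi> = coverage_scale CARD('n) \<rho>"
  have \<phi>: "0 < \<phi>" "1 / \<rho> \<le> \<phi>" and \<phi>_power: "\<phi> ^ CARD('n) = ln \<rho> / \<rho>" and ln_ge_1: "1 \<le> ln \<rho>"
    using coverage_scale_pos[OF large] coverage_scale_ge[OF large] coverage_scale_power[OF large] ln_ge_1[OF large]
    by (auto simp: \<phi>_def)
  define b where "b = box_const"
  have b: "0 < b" "b \<le> 1" using box_const_pos box_const_le_1 by (auto simp: b_def)
  have \<phi>b: "\<phi> \<le> b / 18"
  proof (rule power_le_imp_le_base[of _ "CARD('n) - 1"])
    show "\<phi> ^ Suc (CARD('n) - 1) \<le> (b / 18) ^ Suc (CARD('n) - 1)"
      using dense by (simp add: b_def \<phi>_power)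
  qed (use b in simp)
  have C: "0 < C" using b by (simp add: C_def b_def)
  \<comment> \<open>The choice of \<open>K\<close> gives \<open>9 * \<phi> \<le> b / K\<close>, so that a given target is missed with probability at
    most \<open>\<rho>\<close> to the power \<open>-9\<close>. This beats the union bound over at most \<open>\<rho>\<close> targets and \<open>2 * \<rho> ^ 6\<close> grid times.\<close>
  define K where "K = nat \<lceil>b / 18 / \<phi>\<rceil>"
  have "1 \<le> b / 18 / \<phi>" using \<phi> \<phi>b by simp
  then have K: "b / 18 / \<phi> \<le> real K" "real K \<le> 2 * (b / 18 / \<phi>)" "1 \<le> real K"
    unfolding K_def by linarith+
  \<comment> \<open>The oscillation bound has to pay for \<open>5 * \<rho>\<close> points, \<open>L\<close> intervals and the factor
    \<open>1 / \<phi> ^ 4 \<le> \<rho> ^ 4\<close>, against the square of the interval length \<open>1 / L\<close>.\<close>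
  define L where "L = nat \<lceil>\<rho> ^ 6\<rceil>"
  have "1 \<le> \<rho> ^ 6" using large by simp
  then have L: "\<rho> ^ 6 \<le> real L" "real L \<le> 2 * \<rho> ^ 6" "1 \<le> real L"
    unfolding L_def by linarith+
  \<comment> \<open>Four times the expected number of points, rounded up.\<close>
  define m where "m = nat \<lceil>4 * \<rho>\<rceil>"
  have m: "4 * \<rho> \<le> real m" "real m \<le> 5 * \<rho>"
    using large unfolding m_def by linarith+
  \<comment> \<open>Half of the radius \<open>C * \<phi>\<close> is spent on \<open>20 * a\<close>, the other half on the cells.\<close>
  define a where "a = C * \<phi> / 40"
  have a: "0 < a" using C \<phi> by (simp add: a_def)
  have K0: "0 < K" and L0: "0 < L" using K(3) L(3) by linarith+
  have \<rho>: "0 < \<rho>" using large by simp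
  obtain B where B: "B \<in> events"
    "prob B \<le> exp \<rho> / 2 ^ m + real m * real L * (160 * sqrt 2 ^ CARD('n) * ((1 / real L)\<^sup>2 / a ^ 4))
      + real K ^ CARD('n) * real L * exp (- \<rho> * (box_const / real K) ^ CARD('n))"
    "\<And>\<omega>. \<omega> \<in> space M - B \<Longrightarrow> covered \<rho> (3 * real CARD('n) / real K + 20 * a) \<omega>"
    using coverage_failure[OF \<rho> K0 L0 a, of m] by blast
  have T0: "exp \<rho> / 2 ^ m \<le> exp (- \<rho>)"
  proof -
    have "2 * \<rho> \<le> real m * ln 2"
      using mult_mono[OF m(1) ln2_ge_two_thirds] \<rho> by simp
    then have "exp (2 * \<rho>) \<le> exp (real m * ln 2)" by simp
    also have "\<dots> = 2 ^ m" by (simp add: exp_of_nat_mult)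
    finally have "exp \<rho> / 2 ^ m \<le> exp \<rho> / exp (2 * \<rho>)"
      by (intro divide_left_mono) auto
    also have "\<dots> = exp (- \<rho>)" by (simp flip: exp_diff)
    finally show ?thesis .
  qed
  have T1: "real m * real L * (160 * sqrt 2 ^ CARD('n) * ((1 / real L)\<^sup>2 / a ^ 4))
      \<le> 800 * sqrt 2 ^ CARD('n) * (40 / C) ^ 4 / \<rho>"
  proof -
    have "1 / a \<le> 40 / C * \<rho>"
    proof -
      have "1 / \<phi> \<le> \<rho>" using \<phi> \<rho> by (simp add: divide_le_eq mult.commute)
      from mult_left_mono[OF this, of "40 / C"] show ?thesis using C by (simp add: a_def)
    qed
    then have inv_a: "(1 / a) ^ 4 \<le> (40 / C * \<rho>) ^ 4" using a by (intro power_mono) auto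
    have ratio: "real m * (1 / real L) \<le> 5 * \<rho> * (1 / \<rho> ^ 6)"
      using m(2) L(1) \<rho> L0 by (intro mult_mono divide_left_mono) auto
    have "real m * (1 / real L) * (1 / a) ^ 4 \<le> 5 * \<rho> * (1 / \<rho> ^ 6) * (40 / C * \<rho>) ^ 4"
      by (rule mult_mono[OF ratio inv_a]) (use \<rho> a in simp_all)
    also have "\<dots> = 5 * (40 / C) ^ 4 / \<rho>"
      using \<rho> unfolding power_mult_distrib by (simp add: eval_nat_numeral)
    finally have "160 * sqrt 2 ^ CARD('n) * (real m * (1 / real L) * (1 / a) ^ 4) \<le> 160 * sqrt 2 ^ CARD('n) * (5 * (40 / C) ^ 4 / \<rho>)"
      by (intro mult_left_mono) auto
    moreover have "real m * real L * (160 * sqrt 2 ^ CARD('n) * ((1 / real L)\<^sup>2 / a ^ 4)) =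
        160 * sqrt 2 ^ CARD('n) * (real m * (1 / real L) * (1 / a) ^ 4)"
      using L0 by (simp add: power2_eq_square power_divide)
    ultimately show ?thesis by simp
  qed
  have T2: "real K ^ CARD('n) * real L * exp (- \<rho> * (box_const / real K) ^ CARD('n)) \<le> 2 / \<rho>\<^sup>2"
  proof -
    have "real K \<le> 1 / \<phi>"
      using K(2) b \<phi> by (simp add: field_simps)
    then have "real K ^ CARD('n) \<le> (1 / \<phi>) ^ CARD('n)" by (intro power_mono) auto
    also have "\<dots> = \<rho> / ln \<rho>" by (simp add: power_divide \<phi>_power)
    also have "\<dots> \<le> \<rho> / 1" using ln_ge_1 large by (intro divide_left_mono) auto
    finally have KN: "real K ^ CARD('n) \<le> \<rho>" by simp
    have "9 * \<phi> \<le> b / real K"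
      using K(2,3) \<phi> b by (simp add: field_simps)
    then have "(9 * \<phi>) ^ CARD('n) \<le> (b / real K) ^ CARD('n)"
      using \<phi> by (intro power_mono) auto
    moreover have "9 * (ln \<rho> / \<rho>) \<le> (9 * \<phi>) ^ CARD('n)"
    proof -
      have "(9::real) \<le> 9 ^ CARD('n)" by (intro self_le_power) auto
      then show ?thesis
        using ln_ge_1 large unfolding power_mult_distrib \<phi>_power by (intro mult_right_mono) auto
    qed
    ultimately have "\<rho> * (9 * (ln \<rho> / \<rho>)) \<le> \<rho> * (b / real K) ^ CARD('n)"
      using \<rho> by (intro mult_left_mono) auto
    then have "exp (- \<rho> * (b / real K) ^ CARD('n)) \<le> exp (- (9 * ln \<rho>))" using \<rho> by simp
    also have "\<dots> = 1 / \<rho> ^ 9"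
      using \<rho> exp_of_nat_mult[of 9 "ln \<rho>"] by (simp add: exp_minus inverse_eq_divide)
    finally have "real K ^ CARD('n) * real L * exp (- \<rho> * (b / real K) ^ CARD('n)) \<le> \<rho> * (2 * \<rho> ^ 6) * (1 / \<rho> ^ 9)"
      using KN L(2) \<rho> by (intro mult_mono) auto
    also have "\<dots> = 2 / \<rho>\<^sup>2" using \<rho> by (simp add: eval_nat_numeral)
    finally show ?thesis by (simp add: b_def)
  qed
  have "3 * real CARD('n) / real K \<le> 3 * real CARD('n) / (b / 18 / \<phi>)"
    using K(1,3) \<phi> b by (intro divide_left_mono) auto
  also have "\<dots> = C * \<phi> / 2" using b \<phi> by (simp add: C_def b_def)
  finally have "3 * real CARD('n) / real K + 20 * a \<le> C * \<phi>" by (simp add: a_def)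
  then have "covered \<rho> (C * coverage_scale CARD('n) \<rho>) \<omega>" if "\<omega> \<in> space M - B" for \<omega>
    using covered_mono[OF B(3)[OF that]] by (simp add: \<phi>_def)
  moreover have "prob B \<le> exp (- \<rho>) + 800 * sqrt 2 ^ CARD('n) * (40 / C) ^ 4 / \<rho> + 2 / \<rho>\<^sup>2"
    using B(2) T0 T1 T2 by linarith
  ultimately show ?thesis using that B(1) by blast
qed

end

end

theorem theorem1p4:
  fixes d :: nat
    and M :: "'w measure"
    and Y :: "real \<Rightarrow> nat \<Rightarrow> 'w \<Rightarrow> real ^ 'n"
    and W :: "real \<Rightarrow> nat \<Rightarrow> real \<Rightarrow> 'w \<Rightarrow> real ^ 'n"
  assumes "d \<ge> 2" and "CARD('n) = d - 1"
    and "generalized_cylinder_model M Y W"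
  shows "\<exists>c1 c2 :: real. 0 < c1 \<and> c1 \<le> c2 \<and>
    ((\<lambda>\<rho>. measure M {\<omega> \<in> space M.
        ereal c1 \<le> coverage_radius Y W \<rho> (cball 0 1 \<times> {0}) \<omega> /
                     ereal ((ln \<rho> / \<rho>) powr (1 / (real d - 1))) \<and>
        coverage_radius Y W \<rho> (cball 0 1 \<times> {0}) \<omega> /
                     ereal ((ln \<rho> / \<rho>) powr (1 / (real d - 1))) \<le> ereal c2})
      \<longlongrightarrow> 1) at_top"
proof -
  interpret generalized_cylinder_model M Y W by fact
  define C where "C = 108 * real CARD('n) / box_const"
  define D where "D = 800 * sqrt 2 ^ CARD('n) * (40 / C) ^ 4"
  have "1 \<le> real CARD('n)" by (simp add: Suc_leI)
  then have C: "1 / 6 \<le> C"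
  proof -
    have "1 / 6 * box_const \<le> 108 * real CARD('n)"
      using box_const_le_1 \<open>1 \<le> real CARD('n)\<close> by linarith
    then show ?thesis using box_const_pos by (simp add: C_def le_divide_eq)
  qed
  have dim: "real d - 1 = real CARD('n)" using assms(1,2) by simp
  define good where "good \<rho> = {\<omega> \<in> space M.
    ereal (1 / 6) \<le> radius \<rho> \<omega> / ereal (coverage_scale CARD('n) \<rho>) \<and> radius \<rho> \<omega> / ereal (coverage_scale CARD('n) \<rho>) \<le> ereal C}" for \<rho>
  define err where "err \<rho> = exp (- (exp (- (ln \<rho> / 2)) * (2 * \<rho> / ln \<rho>)))
    + (exp (- \<rho>) + D / \<rho> + 2 / \<rho>\<^sup>2)" for \<rho>
  have bound: "1 - err \<rho> \<le> prob (good \<rho>)"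
    if \<rho>: "3 \<le> \<rho>" and dense: "ln \<rho> / \<rho> \<le> (box_const / 18) ^ CARD('n)" for \<rho>
  proof -
    obtain B where B: "B \<in> events" "prob B \<le> exp (- \<rho>) + D / \<rho> + 2 / \<rho>\<^sup>2"
      "\<And>\<omega>. \<omega> \<in> space M - B \<Longrightarrow> covered \<rho> (C * coverage_scale CARD('n) \<rho>) \<omega>"
      using covered_at_scale[OF \<rho> dense] unfolding D_def C_def by blast
    define A where "A = {\<omega> \<in> space M. radius \<rho> \<omega> < ereal (1 / 6 * coverage_scale CARD('n) \<rho>)}"
    have [measurable]: "radius \<rho> \<in> borel_measurable M" using \<rho> by (intro radius_measurable) simp
    have A: "A \<in> events" unfolding A_def by measurable
    have good_eq: "good \<rho> = {\<omega> \<in> space M. ereal (1 / 6 * coverage_scale CARD('n) \<rho>) \<le> radius \<rho> \<omega> \<and> radius \<rho> \<omega> \<le> ereal (C * coverage_scale CARD('n) \<rho>)}"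
      using coverage_scale_pos[OF \<rho>, of "CARD('n)"] unfolding good_def
      by (subst ereal_le_divide_pos ereal_divide_le_pos, simp, simp)+ (simp add: mult.commute)
    have "good \<rho> \<in> events" unfolding good_eq by measurable
    then have "1 - prob (good \<rho>) = prob (space M - good \<rho>)" by (simp add: prob_compl)
    also have "\<dots> \<le> prob (A \<union> B)"
    proof (rule finite_measure_mono)
      show "space M - good \<rho> \<subseteq> A \<union> B"
      proof
        fix \<omega> assume \<omega>: "\<omega> \<in> space M - good \<rho>"
        have "radius \<rho> \<omega> \<le> ereal (C * coverage_scale CARD('n) \<rho>)" if "\<omega> \<notin> B"
          using radius_le[OF _ B(3)] that \<omega> C coverage_scale_pos[OF \<rho>, of "CARD('n)"] by simp
        then show "\<omega> \<in> A \<union> B" using \<omega> unfolding good_eq A_def by auto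
      qed
    qed (use A B in simp)
    also have "\<dots> \<le> prob A + prob B" by (rule measure_Un_le[OF A B(1)])
    also have "\<dots> \<le> err \<rho>"
      using prob_radius_below_scale[OF \<rho>] B(2) unfolding A_def err_def by linarith
    finally show ?thesis by simp
  qed
  have "((\<lambda>\<rho>::real. ln \<rho> / \<rho>) \<longlongrightarrow> 0) at_top" by real_asymp
  then have "eventually (\<lambda>\<rho>. ln \<rho> / \<rho> < (box_const / 18) ^ CARD('n)) at_top"
    by (rule order_tendstoD) (use box_const_pos in simp)
  then have lower: "eventually (\<lambda>\<rho>. 1 - err \<rho> \<le> prob (good \<rho>)) at_top"
    using eventually_ge_at_top[of 3] by eventually_elim (auto intro: bound)
  have limit: "((\<lambda>\<rho>. 1 - err \<rho>) \<longlongrightarrow> 1) at_top"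
    unfolding err_def by real_asymp
  have "((\<lambda>\<rho>. prob (good \<rho>)) \<longlongrightarrow> 1) at_top"
    by (rule tendsto_sandwich[OF lower _ limit tendsto_const]) simp
  moreover have "0 < (1 / 6 :: real)" by simp
  ultimately show ?thesis
    using C unfolding good_def coverage_scale_def dim by blast
qed

end
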